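(* Let $\chi$ be any probability measure on $\mathbb R^n$, let $R$ be the law on $\Omega=C([0,1],\mathbb R^n)$ of the Brownian motion with initial law $\chi$, and let $\pi$ be a probability measure on $\mathbb R^n\times\mathbb R^n$. The Brenier-Schrödinger problem $$H(P|R)\to\min;\qquad P\in\mathcal P(\Omega),\quad P_t=\mathcal N(0,\tfrac14\mathrm{id})\ \ \forall t\in[0,1],\quad P_{01}=\pi$$ admits a unique solution if and only if $H(\pi|R_{01})<\infty$.
   Context: For $P\in\mathcal P(\Omega)$, $P_t$ is the law of $X_t$ and $P_{01}$ the law of $(X_0,X_1)$ under $P$, where $X_t(\omega)=\omega(t)$; $R_{01}$ is defined likewise. $H(\mu|\nu)=\int\log\frac{d\mu}{d\nu}\,d\mu$ if $\mu\ll\nu$ and $H(\mu|\nu)=\infty$ otherwise. Brownian motion is the standard one (generator $\frac12\Delta$). A solution is a minimiser satisfying the constraints with $H(P|R)<\infty$.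
   Formalization: Both marginals of π are assumed to be N(0, id/4); without this the "if" part fails: for χ = δ₀ and π = R₀₁ one has H(π|R₀₁) = 0, but no admissible P exists. *)

theory Defs
  imports "HOL-Probability.Probability"
begin

text \<open>
  Paths are represented by functions on the reals that are undefined outside \<open>{0..1}\<close>, so each
  element of \<open>C([0,1], \<real>\<^sup>n)\<close> has exactly one representative. The sigma-algebra is the one generated
  by the coordinate maps, which is the Borel sigma-algebra of the uniform topology.
\<close>

definition path_space :: "(real \<Rightarrow> real ^ 'n) measure" where
  "path_space = restrict_space (\<Pi>\<^sub>M t\<in>{0..1}. borel) {\<omega>. continuous_on {0..1} \<omega>}"

definition path_law :: "(real \<Rightarrow> real ^ 'n) measure \<Rightarrow> bool" where
  "path_law P \<longleftrightarrow> prob_space P \<and> sets P = sets path_space"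

definition marginal :: "(real \<Rightarrow> real ^ 'n) measure \<Rightarrow> real \<Rightarrow> (real ^ 'n) measure" where
  "marginal P t = distr P borel (\<lambda>\<omega>. \<omega> t)"

definition endpoint_law :: "(real \<Rightarrow> real ^ 'n) measure \<Rightarrow> ((real ^ 'n) \<times> (real ^ 'n)) measure" where
  "endpoint_law P = distr P borel (\<lambda>\<omega>. (\<omega> 0, \<omega> 1))"

text \<open>The centred Gaussian law with covariance \<open>v\<close> times the identity, for \<open>v > 0\<close>;
  the second parameter of \<^const>\<open>normal_density\<close> is the standard deviation.\<close>

definition centred_gaussian :: "real \<Rightarrow> (real ^ 'n) measure" where
  "centred_gaussian v =
     density lborel (\<lambda>x. ennreal (\<Prod>i\<in>UNIV. normal_density 0 (sqrt v) (x $ i)))"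

text \<open>
  Each increment after time \<open>s\<close> is independent of the whole path up to time \<open>s\<close>, in particular
  of the initial position. These conditions fix all finite-dimensional distributions, so they
  determine \<open>R\<close>.
\<close>

definition brownian_law :: "(real ^ 'n) measure \<Rightarrow> (real \<Rightarrow> real ^ 'n) measure \<Rightarrow> bool" where
  "brownian_law chi R \<longleftrightarrow>
     path_law R \<and> marginal R 0 = chi \<and>
     (\<forall>s t. 0 \<le> s \<and> s < t \<and> t \<le> 1 \<longrightarrow>
        distr R borel (\<lambda>\<omega>. \<omega> t - \<omega> s) = centred_gaussian (t - s) \<and>
        prob_space.indep_set R
          (sets (vimage_algebra (space R) (\<lambda>\<omega>. restrict \<omega> {0..s}) (\<Pi>\<^sub>M r\<in>{0..s}. borel)))
          (sets (vimage_algebra (space R) (\<lambda>\<omega>. \<omega> t - \<omega> s) borel)))"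

text \<open>
  \<open>H(\<mu>|\<nu>)\<close> for probability measures on the same sigma-algebra. \<^const>\<open>KL_divergence\<close> takes the
  reference measure first and is real-valued, with the value \<open>0\<close> when the integral does not
  converge. Since \<open>u * ln u \<ge> - exp (- 1)\<close>, the negative part of \<open>ln (d\<mu>/d\<nu>)\<close> is always
  \<open>\<mu>\<close>-integrable, so failure of integrability means that the integral is \<open>\<infinity>\<close>.
\<close>

definition rel_entropy :: "'a measure \<Rightarrow> 'a measure \<Rightarrow> ereal" where
  "rel_entropy \<mu> \<nu> =
     (if absolutely_continuous \<nu> \<mu> \<and> integrable \<mu> (entropy_density (exp 1) \<nu> \<mu>)
      then ereal (KL_divergence (exp 1) \<nu> \<mu>) else \<infinity>)"

definition BS_admissible ::
  "(real \<Rightarrow> (real ^ 'n) measure) \<Rightarrow> ((real ^ 'n) \<times> (real ^ 'n)) measure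
     \<Rightarrow> (real \<Rightarrow> real ^ 'n) measure \<Rightarrow> bool" where
  "BS_admissible \<mu> \<pi> P \<longleftrightarrow>
     path_law P \<and> (\<forall>t\<in>{0..1}. marginal P t = \<mu> t) \<and> endpoint_law P = \<pi>"

definition BS_solution ::
  "(real \<Rightarrow> real ^ 'n) measure \<Rightarrow> (real \<Rightarrow> (real ^ 'n) measure)
     \<Rightarrow> ((real ^ 'n) \<times> (real ^ 'n)) measure \<Rightarrow> (real \<Rightarrow> real ^ 'n) measure \<Rightarrow> bool" where
  "BS_solution R \<mu> \<pi> P \<longleftrightarrow>
     BS_admissible \<mu> \<pi> P \<and> rel_entropy P R < \<infinity> \<and>
     (\<forall>Q. BS_admissible \<mu> \<pi> Q \<longrightarrow> rel_entropy P R \<le> rel_entropy Q R)"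

end

theory Submission
  imports Defs
begin

text \<open>
  If a solution exists, its entropy is finite, and pushing forward by the endpoint map cannot make
  the entropy infinite. Conversely, let \<open>(X\<^sub>0, X\<^sub>1)\<close> have law \<open>\<pi>\<close>, let \<open>Z\<close> be an independent
  \<open>N(0, 1/4)\<close> variable, and join \<open>X\<^sub>0\<close> to \<open>Z\<close> on \<open>[0, 1/2]\<close> and \<open>Z\<close> to \<open>X\<^sub>1\<close> on \<open>[1/2, 1]\<close> by Brownian bridges. For
  \<open>t \<le> 1/2\<close> the variance of the position at time \<open>t\<close> is
  \<open>((1 - 2 t)\<^sup>2 + (2 t)\<^sup>2) / 4 + t (1 - 2 t) = 1/4\<close>, and likewise for \<open>t \<ge> 1/2\<close>. Relative to \<open>R\<close> this
  law has the density \<open>d\<pi>/dR\<^sub>0\<^sub>1 (X\<^sub>0, X\<^sub>1) * g (X\<^sub>h) / g (X\<^sub>h - (X\<^sub>0 + X\<^sub>1) / 2)\<close> with \<open>h = 1/2\<close> and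
  \<open>g\<close> the density of \<open>N(0, 1/4)\<close>, whose logarithm is that of \<open>d\<pi>/dR\<^sub>0\<^sub>1\<close> plus a quadratic function;
  so the problem is feasible with finite entropy. The entropy is uniformly convex with respect to
  the \<open>L\<^sup>1\<close> distance of densities, so minimising sequences are Cauchy in \<open>L\<^sup>1\<close>; the constraints pass to the
  limit, the entropy is lower semicontinuous by Fatou's lemma, and the minimiser is unique.
\<close>

subsection \<open>Entropy of probability densities\<close>

lemma ln_one_minus_inverse_le:
  fixes x :: real
  assumes "x > 0"
  shows "2 * (1 - 1 / sqrt x) \<le> ln x"
proof -
  have s: "sqrt x > 0" using assms by simp
  \<comment> \<open>The bound \<open>ln y <= y - 1\<close> is taken at the inverse square root; the
    square roots in all later convexity bounds originate here.\<close>
  have "ln (1 / sqrt x) \<le> 1 / sqrt x - 1"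
    using s by (intro ln_le_minus_one) simp
  moreover have "ln (1 / sqrt x) = - (ln x / 2)"
    using assms by (simp add: ln_div ln_sqrt)
  ultimately show ?thesis by simp
qed

text \<open>The square term sharpens \<open>u ln u \<ge> u - 1\<close>; it is what makes the entropy uniformly convex.\<close>

lemma mult_ln_div_ge:
  fixes a s :: real
  assumes "a \<ge> 0" "s > 0"
  shows "a - s + (sqrt a - sqrt s)\<^sup>2 \<le> a * (ln a - ln s)"
proof (cases "a = 0")
  case False
  then have a: "a > 0" using assms by simp
  have "a * (2 * (1 - 1 / sqrt (a / s))) \<le> a * (ln a - ln s)"
    using a assms ln_one_minus_inverse_le[of "a / s"]
    by (intro mult_left_mono) (auto simp: ln_div)
  moreover have "a * (2 * (1 - 1 / sqrt (a / s))) = 2 * a - 2 * (sqrt a * sqrt s)"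
    using a assms by (simp add: real_sqrt_divide field_simps)
  moreover have "(sqrt a - sqrt s)\<^sup>2 = a + s - 2 * (sqrt a * sqrt s)"
    using a assms by (simp add: power2_diff)
  ultimately show ?thesis by linarith
qed (use assms in auto)

lemma mult_ln_ge_minus_one:
  fixes a :: real
  assumes "a \<ge> 0"
  shows "a - 1 \<le> a * ln a"
  using mult_ln_div_ge[OF assms zero_less_one] zero_le_power2[of "sqrt a - 1"]
  unfolding ln_one real_sqrt_one diff_zero by linarith

text \<open>Comparing \<open>a\<close> and \<open>b\<close> with their mean \<open>s\<close> through
  \<open>mult_ln_div_ge\<close>, the linear terms \<open>a - s\<close> and \<open>b - s\<close>
  cancel and only the two squares survive. The gap in Jensen's inequality at the midpoint thus
  controls a pointwise Hellinger distance.\<close>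

lemma sqrt_diff_le_entropy_gap:
  fixes a b :: real
  assumes "a \<ge> 0" "b \<ge> 0"
  shows "(sqrt a - sqrt b)\<^sup>2 / 4 \<le> (a * ln a + b * ln b) / 2 - (a + b) / 2 * ln ((a + b) / 2)"
proof (cases "a + b = 0")
  case False
  define s where "s = (a + b) / 2"
  have s: "s > 0" using False assms by (simp add: s_def)
  define X Y D where "X = (sqrt a - sqrt s)\<^sup>2" and "Y = (sqrt b - sqrt s)\<^sup>2"
    and "D = (sqrt a - sqrt b)\<^sup>2"
  note defs = this
  have *: "a - s + (sqrt a - sqrt s)\<^sup>2 + (b - s + (sqrt b - sqrt s)\<^sup>2)
      \<le> a * (ln a - ln s) + b * (ln b - ln s)"
    by (intro add_mono mult_ln_div_ge assms s)
  have "a - s + (b - s) = 0" by (simp add: s_def)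
  moreover have "a * (ln a - ln s) + b * (ln b - ln s) = a * ln a + b * ln b - 2 * (s * ln s)"
    by (simp add: s_def field_simps)
  note *[unfolded this, folded defs]
  moreover have "D \<le> 2 * (X + Y)"
  proof -
    have "(p - q)\<^sup>2 \<le> 2 * ((p - r)\<^sup>2 + (q - r)\<^sup>2)" for p q r :: real
      using zero_le_power2[of "p + q - 2 * r"] by (simp add: power2_eq_square algebra_simps)
    then show ?thesis unfolding defs .
  qed
  ultimately have "D / 4 \<le> (a * ln a + b * ln b) / 2 - s * ln s"
    by (simp add: field_simps)
  then show ?thesis unfolding s_def defs .
next
  case True
  then have "a = 0" "b = 0" using assms by auto
  then show ?thesis by simp
qed

text \<open>The difference factors through the square roots, and Young's inequality with a free
  weight \<open>e\<close> separates the factors: the difference of the roots is controlled by the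
  entropy gap, their sum by \<open>a + b\<close>. Keeping \<open>e\<close> free makes the bound
  linear in the gap, so it can be integrated.\<close>

lemma abs_diff_le_entropy_gap:
  fixes a b e :: real
  assumes "a \<ge> 0" "b \<ge> 0" "e > 0"
  shows "\<bar>a - b\<bar> \<le> e * (a + b)
    + 2 / e * ((a * ln a + b * ln b) / 2 - (a + b) / 2 * ln ((a + b) / 2))"
proof -
  define u v where "u = \<bar>sqrt a - sqrt b\<bar>" and "v = sqrt a + sqrt b"
  have "\<bar>a - b\<bar> = u * v"
  proof -
    have "a - b = (sqrt a - sqrt b) * (sqrt a + sqrt b)"
      using assms by (simp add: algebra_simps)
    then show ?thesis using assms by (simp add: u_def v_def abs_mult)
  qed
  also have "u * v \<le> u\<^sup>2 / (2 * e) + e * v\<^sup>2 / 2"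
    using zero_le_power2[of "u - e * v"] assms
    by (simp add: field_simps power2_eq_square)
  also have "\<dots> \<le> e * (a + b)
    + 2 / e * ((a * ln a + b * ln b) / 2 - (a + b) / 2 * ln ((a + b) / 2))"
  proof -
    have "v\<^sup>2 \<le> 2 * (a + b)"
      using zero_le_power2[of "sqrt a - sqrt b"] assms
      by (simp add: v_def power2_eq_square algebra_simps)
    then have "e * v\<^sup>2 \<le> e * (2 * (a + b))"
      using assms by (intro mult_left_mono) auto
    moreover have "2 / e * (u\<^sup>2 / 4) \<le>
        2 / e * ((a * ln a + b * ln b) / 2 - (a + b) / 2 * ln ((a + b) / 2))"
      using assms sqrt_diff_le_entropy_gap[OF assms(1,2)]
      by (intro mult_left_mono) (auto simp: u_def)
    moreover have "u\<^sup>2 / (2 * e) = 2 / e * (u\<^sup>2 / 4)" by simp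
    ultimately show ?thesis by linarith
  qed
  finally show ?thesis .
qed

text \<open>Nonnegativity is demanded at every point, so the real inequalities above apply without
  an exceptional null set.\<close>

definition prob_density_on :: "'a measure \<Rightarrow> ('a \<Rightarrow> real) \<Rightarrow> bool" where
  "prob_density_on R f \<longleftrightarrow>
     f \<in> borel_measurable R \<and> (\<forall>x. 0 \<le> f x) \<and> integrable R f \<and> (\<integral>x. f x \<partial>R) = 1"

lemma prob_density_onD:
  assumes "prob_density_on R f"
  shows "f \<in> borel_measurable R" "\<And>x. 0 \<le> f x" "integrable R f" "(\<integral>x. f x \<partial>R) = 1"
  using assms by (auto simp: prob_density_on_def)

lemma prob_density_on_iff:
  assumes [measurable]: "f \<in> borel_measurable R" and "\<And>x. 0 \<le> f x"
  shows "prob_density_on R f \<longleftrightarrow> prob_space (density R f)"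
proof -
  have e: "emeasure (density R f) (space (density R f)) = (\<integral>\<^sup>+x. ennreal (f x) \<partial>R)"
    by (simp add: emeasure_density cong: nn_integral_cong_simp)
  have "prob_space (density R f) \<longleftrightarrow> (\<integral>\<^sup>+x. ennreal (f x) \<partial>R) = 1"
    unfolding e[symmetric] by (metis prob_space.emeasure_space_1 prob_spaceI)
  also have "\<dots> \<longleftrightarrow> prob_density_on R f"
  proof
    assume eq: "(\<integral>\<^sup>+x. ennreal (f x) \<partial>R) = 1"
    then have "has_bochner_integral R f 1"
      using assms by (intro has_bochner_integral_nn_integral) auto
    then show "prob_density_on R f"
      using assms by (auto simp: prob_density_on_def has_bochner_integral_iff)
  next
    assume "prob_density_on R f"
    then show "(\<integral>\<^sup>+x. ennreal (f x) \<partial>R) = 1"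
      by (subst nn_integral_eq_integral) (auto simp: prob_density_on_def)
  qed
  finally show ?thesis ..
qed

section \<open>Relative entropy as the integral of \<open>f ln f\<close>\<close>

context prob_space
begin

text \<open>The Radon-Nikodym derivative of \<open>density M f\<close> agrees with \<open>f\<close>
  almost everywhere; with base \<open>exp 1\<close> the entropy density is therefore
  \<open>ln f\<close>, weighted by \<open>f\<close> under the integral.\<close>

lemma rel_entropy_density:
  assumes "prob_density_on M f"
  shows "rel_entropy (density M f) M =
    (if integrable M (\<lambda>x. f x * ln (f x)) then ereal (\<integral>x. f x * ln (f x) \<partial>M) else \<infinity>)"
proof -
  note f = prob_density_onD[OF assms]
  note [measurable] = f(1)
  have "AE x in M. ennreal (f x) = RN_deriv M (density M f) x"
    by (intro RN_deriv_unique) auto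
  then have eq: "AE x in M. f x * entropy_density (exp 1) M (density M f) x = f x * ln (f x)"
  proof eventually_elim
    case (elim x)
    then show ?case using f(2)[of x] by (simp add: entropy_density_def log_def flip: elim)
  qed
  have "integrable (density M f) (entropy_density (exp 1) M (density M f))
      \<longleftrightarrow> integrable M (\<lambda>x. f x * entropy_density (exp 1) M (density M f) x)"
    using f(2) by (simp add: integrable_density)
  also have "\<dots> \<longleftrightarrow> integrable M (\<lambda>x. f x * ln (f x))"
    by (rule integrable_cong_AE[OF _ _ eq]) measurable
  finally have 1: "integrable (density M f) (entropy_density (exp 1) M (density M f))
      \<longleftrightarrow> integrable M (\<lambda>x. f x * ln (f x))" .
  have 2: "KL_divergence (exp 1) M (density M f) = (\<integral>x. f x * ln (f x) \<partial>M)"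
    using f(2) by (subst KL_density) (auto simp: log_def)
  show ?thesis
    unfolding rel_entropy_def 1 2 by (simp add: absolutely_continuousI_density)
qed

lemma finite_rel_entropyE:
  assumes "prob_space P" "sets P = sets M" "rel_entropy P M < \<infinity>"
  obtains f where "prob_density_on M f" "P = density M f" "integrable M (\<lambda>x. f x * ln (f x))"
    "rel_entropy P M = ereal (\<integral>x. f x * ln (f x) \<partial>M)"
proof -
  interpret P: prob_space P by fact
  have ac: "absolutely_continuous M P" using assms(3) by (auto simp: rel_entropy_def split: if_splits)
  \<comment> \<open>A real-valued version of the derivative: \<open>enn2real\<close> sends the value
    infinity to 0, and this happens only on a null set.\<close>
  define f where "f x = enn2real (RN_deriv M P x)" for x
  have [measurable]: "f \<in> borel_measurable M" and f_nonneg: "\<And>x. 0 \<le> f x"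
    by (simp_all add: f_def[abs_def])
  have "AE x in M. RN_deriv M P x \<noteq> \<infinity>"
    by (intro RN_deriv_finite P.sigma_finite_measure_axioms ac assms(2))
  then have "density M (\<lambda>x. ennreal (f x)) = density M (RN_deriv M P)"
    by (intro density_cong) (auto simp: f_def less_top)
  then have P: "P = density M f" using density_RN_deriv[OF ac assms(2)] by simp
  have f: "prob_density_on M f"
    using assms(1) by (subst prob_density_on_iff) (auto simp: f_nonneg simp flip: P)
  from assms(3) have "integrable M (\<lambda>x. f x * ln (f x))"
    unfolding P rel_entropy_density[OF f] by (auto split: if_splits)
  with rel_entropy_density[OF f] show ?thesis
    by (intro that[OF f P]) (simp_all flip: P)
qed

end

subsection \<open>Entropy projections\<close>

lemma nn_integral_le_of_AE_tendsto:
  fixes g :: "'a \<Rightarrow> ennreal"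
  assumes [measurable]: "\<And>n. u n \<in> borel_measurable M"
    and lim: "AE x in M. (\<lambda>n. u n x) \<longlonglongrightarrow> g x"
    and le: "eventually (\<lambda>n. (\<integral>\<^sup>+x. u n x \<partial>M) \<le> C) sequentially"
  shows "(\<integral>\<^sup>+x. g x \<partial>M) \<le> C"
proof -
  have "(\<integral>\<^sup>+x. g x \<partial>M) = (\<integral>\<^sup>+x. liminf (\<lambda>n. u n x) \<partial>M)"
    using lim by (intro nn_integral_cong_AE) (auto simp: lim_imp_Liminf)
  also have "\<dots> \<le> liminf (\<lambda>n. \<integral>\<^sup>+x. u n x \<partial>M)"
    by (rule nn_integral_liminf) simp
  also have "\<dots> \<le> limsup (\<lambda>n. \<integral>\<^sup>+x. u n x \<partial>M)"
    by (rule Liminf_le_Limsup) simp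
  also have "\<dots> \<le> C" by (rule Limsup_bounded[OF le])
  finally show ?thesis .
qed

lemma mult_ln_le_square:
  fixes u :: real
  assumes "u \<ge> 0"
  shows "u * ln u \<le> u * (u - 1)"
proof (cases "u = 0")
  case False
  then show ?thesis using assms by (intro mult_left_mono ln_le_minus_one) auto
qed simp

text \<open>Away from 0 this is continuity of \<open>ln\<close>. At the limit 0 the product is
  squeezed between \<open>2 u - 2 sqrt u\<close>, which is \<open>mult_ln_div_ge\<close> at
  \<open>s = 1\<close>, and \<open>u (u - 1)\<close>.\<close>

lemma tendsto_mult_ln:
  fixes u :: "nat \<Rightarrow> real"
  assumes u: "u \<longlonglongrightarrow> l" and nn: "\<And>n. 0 \<le> u n"
  shows "(\<lambda>n. u n * ln (u n)) \<longlonglongrightarrow> l * ln l"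
proof (cases "l = 0")
  case True
  have u0: "u \<longlonglongrightarrow> 0" using u True by simp
  have "(\<lambda>n. u n * ln (u n)) \<longlonglongrightarrow> 0"
  proof (rule tendsto_sandwich)
    have "2 * u n - 2 * sqrt (u n) \<le> u n * ln (u n)" for n
      using mult_ln_div_ge[OF nn[of n] zero_less_one] nn[of n] by (simp add: power2_diff)
    then show "eventually (\<lambda>n. 2 * u n - 2 * sqrt (u n) \<le> u n * ln (u n)) sequentially"
      by simp
    show "eventually (\<lambda>n. u n * ln (u n) \<le> u n * (u n - 1)) sequentially"
      using mult_ln_le_square[OF nn] by simp
    show "(\<lambda>n. 2 * u n - 2 * sqrt (u n)) \<longlonglongrightarrow> 0"
      by (rule tendsto_eq_intros u0 refl | simp)+
    show "(\<lambda>n. u n * (u n - 1)) \<longlonglongrightarrow> 0"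
      by (rule tendsto_eq_intros u0 refl | simp)+
  qed
  then show ?thesis using True by simp
next
  case False
  show ?thesis by (rule tendsto_mult[OF u tendsto_ln[OF u False]])
qed

text \<open>Each pair \<open>(E, c)\<close> in \<open>K\<close> is a linear constraint on the
  density, so the constraints survive midpoints and L1 limits; the minimisation rests on these two
  closure properties.\<close>

definition finite_entropy_densities :: "'a measure \<Rightarrow> ('a set \<times> real) set \<Rightarrow> ('a \<Rightarrow> real) set" where
  "finite_entropy_densities M K = {f. prob_density_on M f \<and> integrable M (\<lambda>x. f x * ln (f x)) \<and>
     (\<forall>(E, c)\<in>K. (\<integral>x. indicator E x * f x \<partial>M) = c)}"

section \<open>Existence and uniqueness of entropy-minimising densities\<close>

context prob_space
begin

abbreviation ent :: "('a \<Rightarrow> real) \<Rightarrow> real" where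
  "ent f \<equiv> (\<integral>x. f x * ln (f x) \<partial>M)"

lemma ent_nonneg:
  assumes "prob_density_on M f" "integrable M (\<lambda>x. f x * ln (f x))"
  shows "0 \<le> ent f"
proof -
  note f = prob_density_onD[OF assms(1)]
  have "(\<integral>x. f x - 1 \<partial>M) \<le> ent f"
    using f assms(2) by (intro integral_mono) (auto intro: mult_ln_ge_minus_one)
  then show ?thesis using f by (simp add: prob_space)
qed

lemma midpoint_in_finite_entropy_densities:
  assumes K: "\<And>E c. (E, c) \<in> K \<Longrightarrow> E \<in> events"
    and "f \<in> finite_entropy_densities M K" "g \<in> finite_entropy_densities M K"
  shows "(\<lambda>x. (f x + g x) / 2) \<in> finite_entropy_densities M K"
proof -
  have f: "prob_density_on M f" "integrable M (\<lambda>x. f x * ln (f x))"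
      "\<And>E c. (E, c) \<in> K \<Longrightarrow> (\<integral>x. indicator E x * f x \<partial>M) = c"
    and g: "prob_density_on M g" "integrable M (\<lambda>x. g x * ln (g x))"
      "\<And>E c. (E, c) \<in> K \<Longrightarrow> (\<integral>x. indicator E x * g x \<partial>M) = c"
    using assms(2,3) by (auto simp: finite_entropy_densities_def)
  note fd = prob_density_onD[OF f(1)] and gd = prob_density_onD[OF g(1)]
  note [measurable] = fd(1) gd(1)
  have 1: "prob_density_on M (\<lambda>x. (f x + g x) / 2)"
    using fd gd by (auto simp: prob_density_on_def)
  \<comment> \<open>With \<open>u\<close> the midpoint, \<open>u ln u\<close> lies between
    \<open>u - 1\<close> and, by convexity, the average of the two given integrands; both bounds are
    integrable.\<close>
  have 2: "integrable M (\<lambda>x. (f x + g x) / 2 * ln ((f x + g x) / 2))"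
  proof (rule Bochner_Integration.integrable_bound)
    show "integrable M (\<lambda>x. \<bar>f x * ln (f x)\<bar> + \<bar>g x * ln (g x)\<bar> + f x + g x + 1)"
      using f g fd gd by auto
    show "AE x in M. norm ((f x + g x) / 2 * ln ((f x + g x) / 2))
        \<le> norm (\<bar>f x * ln (f x)\<bar> + \<bar>g x * ln (g x)\<bar> + f x + g x + 1)"
    proof (rule AE_I2)
      fix x
      have arith: "(a + b) / 2 - 1 \<le> z \<Longrightarrow> z \<le> (p + q) / 2 \<Longrightarrow> 0 \<le> a \<Longrightarrow> 0 \<le> b \<Longrightarrow>
          \<bar>z\<bar> \<le> \<bar>\<bar>p\<bar> + \<bar>q\<bar> + a + b + 1\<bar>" for a b z p q :: real
        by argo
      have nn: "0 \<le> f x" "0 \<le> g x" using fd gd by auto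
      have "(f x + g x) / 2 - 1 \<le> (f x + g x) / 2 * ln ((f x + g x) / 2)"
        using nn by (intro mult_ln_ge_minus_one) auto
      moreover have "(f x + g x) / 2 * ln ((f x + g x) / 2)
          \<le> (f x * ln (f x) + g x * ln (g x)) / 2"
        using sqrt_diff_le_entropy_gap[OF nn] zero_le_power2[of "sqrt (f x) - sqrt (g x)"]
        by linarith
      ultimately show "norm ((f x + g x) / 2 * ln ((f x + g x) / 2))
          \<le> norm (\<bar>f x * ln (f x)\<bar> + \<bar>g x * ln (g x)\<bar> + f x + g x + 1)"
        using nn arith unfolding real_norm_def by blast
    qed
  qed measurable
  have "(\<integral>x. indicator E x * ((f x + g x) / 2) \<partial>M) = c" if "(E, c) \<in> K" for E c
  proof -
    note [measurable] = K[OF that]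
    have i: "integrable M (\<lambda>x. indicator E x * f x)" "integrable M (\<lambda>x. indicator E x * g x)"
      using fd gd K[OF that] by (auto intro: integrable_real_mult_indicator simp: mult.commute)
    have "(\<integral>x. indicator E x * ((f x + g x) / 2) \<partial>M)
        = (\<integral>x. (indicator E x * f x + indicator E x * g x) / 2 \<partial>M)"
      by (intro Bochner_Integration.integral_cong) (auto simp: distrib_left)
    also have "\<dots> = (c + c) / 2"
      using i f(3)[OF that] g(3)[OF that] by simp
    finally show ?thesis by simp
  qed
  with 1 2 show ?thesis by (auto simp: finite_entropy_densities_def)
qed

text \<open>The pointwise bound \<open>abs_diff_le_entropy_gap\<close> is integrated; each density
  has mass one, which turns \<open>e * (a + b)\<close> into \<open>2 * e\<close>.\<close>

lemma L1_dist_le_entropy_gap: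
  assumes K: "\<And>E c. (E, c) \<in> K \<Longrightarrow> E \<in> events"
    and f: "f \<in> finite_entropy_densities M K" and g: "g \<in> finite_entropy_densities M K"
    and e: "e > 0"
  shows "(\<integral>x. \<bar>f x - g x\<bar> \<partial>M)
    \<le> 2 * e + 2 / e * ((ent f + ent g) / 2 - ent (\<lambda>x. (f x + g x) / 2))"
proof -
  have mid: "integrable M (\<lambda>x. (f x + g x) / 2 * ln ((f x + g x) / 2))"
    using midpoint_in_finite_entropy_densities[OF K f g]
    by (simp add: finite_entropy_densities_def)
  have f': "prob_density_on M f" "integrable M (\<lambda>x. f x * ln (f x))"
    and g': "prob_density_on M g" "integrable M (\<lambda>x. g x * ln (g x))"
    using f g by (auto simp: finite_entropy_densities_def)
  note fd = prob_density_onD[OF f'(1)] and gd = prob_density_onD[OF g'(1)]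
  define p q w where "p x = f x * ln (f x)" and "q x = g x * ln (g x)"
    and "w x = (f x + g x) / 2 * ln ((f x + g x) / 2)" for x
  note defs = p_def q_def w_def
  have int: "integrable M p" "integrable M q" "integrable M w"
    using f' g' mid by (simp_all add: defs[abs_def])
  have "(\<integral>x. \<bar>f x - g x\<bar> \<partial>M) \<le> (\<integral>x. e * (f x + g x) + 2 / e * ((p x + q x) / 2 - w x) \<partial>M)"
  proof (rule integral_mono)
    show "\<bar>f x - g x\<bar> \<le> e * (f x + g x) + 2 / e * ((p x + q x) / 2 - w x)" for x
      unfolding defs using fd gd e by (intro abs_diff_le_entropy_gap) auto
    show "integrable M (\<lambda>x. \<bar>f x - g x\<bar>)" using fd gd by auto
    show "integrable M (\<lambda>x. e * (f x + g x) + 2 / e * ((p x + q x) / 2 - w x))"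
      using int fd(3) gd(3)
      by (intro Bochner_Integration.integrable_add Bochner_Integration.integrable_diff
          integrable_mult_right integrable_divide) auto
  qed
  also have "\<dots> = e * (1 + 1) + 2 / e * (((\<integral>x. p x \<partial>M) + (\<integral>x. q x \<partial>M)) / 2 - (\<integral>x. w x \<partial>M))"
    using int fd gd by simp
  finally show ?thesis by (simp add: defs)
qed

text \<open>Midpoints of a minimising sequence are competitors, so their entropy is at least the
  infimum \<open>m\<close> and the gap between two late members is small. Hence the sequence is
  Cauchy in L1; a subsequence converges almost everywhere, and its limit is the minimiser.\<close>

lemma entropy_minimiser_exists:
  assumes K: "\<And>E c. (E, c) \<in> K \<Longrightarrow> E \<in> events"
    and ne: "finite_entropy_densities M K \<noteq> {}"
  obtains f where "f \<in> finite_entropy_densities M K"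
    "\<And>g. g \<in> finite_entropy_densities M K \<Longrightarrow> ent f \<le> ent g"
proof -
  let ?F = "finite_entropy_densities M K"
  define m where "m = Inf (ent ` ?F)"
  have bdd: "bdd_below (ent ` ?F)"
    by (rule bdd_belowI[of _ 0]) (auto simp: finite_entropy_densities_def intro: ent_nonneg)
  have m_nonneg: "0 \<le> m"
    unfolding m_def using ne
    by (intro cInf_greatest) (auto simp: finite_entropy_densities_def intro: ent_nonneg)
  have m_le: "m \<le> ent g" if "g \<in> ?F" for g
    unfolding m_def using that by (intro cInf_lower bdd) auto
  have "\<exists>g\<in>?F. ent g < m + 1 / real (Suc n)" for n
    using cInf_lessD[of "ent ` ?F" "m + 1 / real (Suc n)"] ne by (auto simp: m_def)
  then obtain s where sF: "\<And>n. s n \<in> ?F" and s_lt: "\<And>n. ent (s n) < m + 1 / real (Suc n)"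
    by metis
  have sd: "prob_density_on M (s n)" "integrable M (\<lambda>x. s n x * ln (s n x))"
      "\<And>E c. (E, c) \<in> K \<Longrightarrow> (\<integral>x. indicator E x * s n x \<partial>M) = c" for n
    using sF[of n] by (auto simp: finite_entropy_densities_def)
  note sd' = prob_density_onD[OF sd(1)]
  note [measurable] = sd'(1)
  have cauchy: "\<exists>N. \<forall>i\<ge>N. \<forall>j\<ge>N. (\<integral>x. norm (s i x - s j x) \<partial>M) < e" if "e > 0" for e :: real
  proof -
    \<comment> \<open>With parameter \<open>e / 4\<close> the L1 bound is
      \<open>e / 2 + (8 / e) / (N + 1)\<close>, which is below \<open>e\<close> once
      \<open>N + 1\<close> exceeds \<open>16 / e^2\<close>.\<close>
    obtain N :: nat where N: "16 / e\<^sup>2 < real N" using reals_Archimedean2 by blast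
    have arith: "a \<le> b \<Longrightarrow> c < a + d \<Longrightarrow> c' < a + d' \<Longrightarrow> d \<le> k \<Longrightarrow> d' \<le> k \<Longrightarrow> (c + c') / 2 - b \<le> k"
      for a b c c' d d' k :: real by argo
    show ?thesis
    proof (intro exI[of _ N] allI impI)
      fix i j assume ij: "N \<le> i" "N \<le> j"
      have inv: "1 / real (Suc k) \<le> 1 / real (Suc N)" if "N \<le> k" for k
        using that by (intro divide_left_mono) auto
      have "m \<le> ent (\<lambda>x. (s i x + s j x) / 2)"
        by (intro m_le midpoint_in_finite_entropy_densities K sF)
      then have gap: "(ent (s i) + ent (s j)) / 2 - ent (\<lambda>x. (s i x + s j x) / 2) \<le> 1 / real (Suc N)"
        using s_lt[of i] s_lt[of j] inv[OF ij(1)] inv[OF ij(2)]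
          arith[of m "ent (\<lambda>x. (s i x + s j x) / 2)"] by blast
      have "(\<integral>x. norm (s i x - s j x) \<partial>M) \<le> 2 * (e / 4) + 2 / (e / 4) *
          ((ent (s i) + ent (s j)) / 2 - ent (\<lambda>x. (s i x + s j x) / 2))"
        using L1_dist_le_entropy_gap[OF K sF[of i] sF[of j], where e = "e / 4"] that by simp
      also have "\<dots> \<le> 2 * (e / 4) + 2 / (e / 4) * (1 / real (Suc N))"
        using gap that by (intro add_left_mono mult_left_mono) auto
      also have "\<dots> < e"
      proof -
        have "16 / e\<^sup>2 < real (Suc N)" using N by simp
        then have "16 < e * (e * real (Suc N))"
          using that by (simp add: divide_less_eq power2_eq_square mult_ac del: of_nat_Suc)
        then show ?thesis using that by (simp add: field_simps del: of_nat_Suc)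
      qed
      finally show "(\<integral>x. norm (s i x - s j x) \<partial>M) < e" .
    qed
  qed
  obtain r where r: "strict_mono r" and ae: "AE x in M. Cauchy (\<lambda>i. s (r i) x)"
    using cauchy_L1_AE_cauchy_subseq[OF sd'(3) cauchy] by blast
  \<comment> \<open>The value 0 off the convergence set keeps \<open>f\<close> measurable and
    nonnegative everywhere.\<close>
  define f where "f x = (if Cauchy (\<lambda>i. s (r i) x) then lim (\<lambda>i. s (r i) x) else 0)" for x
  have [measurable]: "f \<in> borel_measurable M" unfolding f_def[abs_def] by measurable
  have lim: "(\<lambda>i. s (r i) x) \<longlonglongrightarrow> f x" if "Cauchy (\<lambda>i. s (r i) x)" for x
    using that by (simp add: f_def Cauchy_convergent_iff convergent_LIMSEQ_iff)
  have nn: "0 \<le> f x" for x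
  proof (cases "Cauchy (\<lambda>i. s (r i) x)")
    case True
    show ?thesis by (rule LIMSEQ_le_const[OF lim[OF True]]) (auto simp: sd'(2))
  qed (simp add: f_def)
  \<comment> \<open>Fatou's lemma in the second index of the Cauchy estimate upgrades
    almost-everywhere convergence to L1 convergence.\<close>
  have L1: "\<exists>N. \<forall>i\<ge>N. (\<integral>\<^sup>+x. ennreal \<bar>s (r i) x - f x\<bar> \<partial>M) \<le> ennreal e" if e_pos: "e > 0" for e :: real
  proof -
    obtain N where N: "\<And>i j. i \<ge> N \<Longrightarrow> j \<ge> N \<Longrightarrow> (\<integral>x. norm (s i x - s j x) \<partial>M) < e"
      using cauchy[OF e_pos] by blast
    have "(\<integral>\<^sup>+x. ennreal \<bar>s (r i) x - f x\<bar> \<partial>M) \<le> ennreal e" if i: "i \<ge> N" for i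
    proof (rule nn_integral_le_of_AE_tendsto[where u = "\<lambda>j x. ennreal \<bar>s (r i) x - s (r j) x\<bar>"])
      show "AE x in M. (\<lambda>n. ennreal \<bar>s (r i) x - s (r n) x\<bar>) \<longlonglongrightarrow> ennreal \<bar>s (r i) x - f x\<bar>"
        using ae by eventually_elim (intro tendsto_intros lim)
      have "(\<integral>\<^sup>+x. ennreal \<bar>s (r i) x - s (r j) x\<bar> \<partial>M) \<le> ennreal e" if "j \<ge> N" for j
      proof -
        have "(\<integral>x. \<bar>s (r i) x - s (r j) x\<bar> \<partial>M) < e"
          using N[of "r i" "r j"] seq_suble[OF r, of i] seq_suble[OF r, of j] i that by simp
        then show ?thesis
          using sd'(3) by (subst nn_integral_eq_integral) (auto intro: ennreal_leI)
      qed
      then show "eventually (\<lambda>j. (\<integral>\<^sup>+x. ennreal \<bar>s (r i) x - s (r j) x\<bar> \<partial>M) \<le> ennreal e) sequentially"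
        unfolding eventually_sequentially by blast
    qed measurable
    then show ?thesis by blast
  qed
  have int_f: "integrable M f"
  proof -
    obtain N where "(\<integral>\<^sup>+x. ennreal \<bar>s (r N) x - f x\<bar> \<partial>M) \<le> ennreal 1"
      using L1[of 1] by auto
    then have "integrable M (\<lambda>x. s (r N) x - f x)"
      by (intro integrableI_bounded) (auto simp: le_less_trans)
    from Bochner_Integration.integrable_diff[OF sd'(3) this]
    have "integrable M (\<lambda>x. s (r N) x - (s (r N) x - f x))" .
    moreover have "(\<lambda>x. s (r N) x - (s (r N) x - f x)) = f" by auto
    ultimately show ?thesis by metis
  qed
  have tend: "(\<lambda>i. \<integral>x. indicator E x * s (r i) x \<partial>M) \<longlonglongrightarrow> (\<integral>x. indicator E x * f x \<partial>M)"
    if E[measurable]: "E \<in> events" for E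
  proof (rule LIMSEQ_I)
    fix e :: real assume "e > 0"
    then obtain N where N: "\<And>i. i \<ge> N \<Longrightarrow> (\<integral>\<^sup>+x. ennreal \<bar>s (r i) x - f x\<bar> \<partial>M) \<le> ennreal (e / 2)"
      using L1[of "e / 2"] by auto
    have "norm ((\<integral>x. indicator E x * s (r i) x \<partial>M) - (\<integral>x. indicator E x * f x \<partial>M)) < e"
      if "i \<ge> N" for i
    proof -
      have "integrable M (\<lambda>x. indicator E x * s (r i) x)" "integrable M (\<lambda>x. indicator E x * f x)"
        using integrable_mult_indicator[OF E sd'(3)] integrable_mult_indicator[OF E int_f]
        by simp_all
      note int = this
      then have "norm ((\<integral>x. indicator E x * s (r i) x \<partial>M) - (\<integral>x. indicator E x * f x \<partial>M))
          = norm (\<integral>x. indicator E x * s (r i) x - indicator E x * f x \<partial>M)"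
        by simp
      also have "ennreal \<dots> \<le> (\<integral>\<^sup>+x. ennreal \<bar>s (r i) x - f x\<bar> \<partial>M)"
        using int
        by (intro order_trans[OF integral_norm_bound_ennreal] nn_integral_mono ennreal_leI)
           (auto split: split_indicator)
      also have "\<dots> \<le> ennreal (e / 2)" by (rule N[OF that])
      finally have "norm ((\<integral>x. indicator E x * s (r i) x \<partial>M) - (\<integral>x. indicator E x * f x \<partial>M)) \<le> e / 2"
        using \<open>e > 0\<close> by (simp add: ennreal_le_iff)
      then show ?thesis using \<open>e > 0\<close> by simp
    qed
    then show "\<exists>no. \<forall>n\<ge>no. norm ((\<integral>x. indicator E x * s (r n) x \<partial>M)
        - (\<integral>x. indicator E x * f x \<partial>M)) < e" by blast
  qed
  \<comment> \<open>Taking the whole space as the event shows that no mass is lost in the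
    limit.\<close>
  have "(\<lambda>i. \<integral>x. indicator (space M) x * s (r i) x \<partial>M) \<longlonglongrightarrow> (\<integral>x. indicator (space M) x * f x \<partial>M)"
    by (rule tend) simp
  moreover have "(\<integral>x. indicator (space M) x * g x \<partial>M) = (\<integral>x. g x \<partial>M)" for g :: "'a \<Rightarrow> real"
    by (intro Bochner_Integration.integral_cong) auto
  ultimately have "(\<integral>x. f x \<partial>M) = 1" using sd'(4) by (simp add: LIMSEQ_const_iff)
  then have f: "prob_density_on M f" using nn int_f by (auto simp: prob_density_on_def)
  have cstr: "(\<integral>x. indicator E x * f x \<partial>M) = c" if "(E, c) \<in> K" for E c
    using tend[OF K[OF that]] sd(3)[OF that] by (simp add: LIMSEQ_const_iff)
  \<comment> \<open>Since \<open>u ln u\<close> changes sign, Fatou's lemma is applied to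
    \<open>u ln u - u + 1\<close>, which is nonnegative and has the same integral when
    \<open>u\<close> is a probability density.\<close>
  have ent_f: "(\<integral>\<^sup>+x. ennreal (f x * ln (f x) - f x + 1) \<partial>M) \<le> ennreal (m + e)" if "e > 0" for e :: real
  proof (rule nn_integral_le_of_AE_tendsto
      [where u = "\<lambda>i x. ennreal (s (r i) x * ln (s (r i) x) - s (r i) x + 1)"])
    show "AE x in M. (\<lambda>i. ennreal (s (r i) x * ln (s (r i) x) - s (r i) x + 1))
        \<longlonglongrightarrow> ennreal (f x * ln (f x) - f x + 1)"
      using ae by eventually_elim (intro tendsto_intros tendsto_mult_ln lim sd'(2))
    obtain N :: nat where N: "1 / e < real N" using reals_Archimedean2 by blast
    have "(\<integral>\<^sup>+x. ennreal (s (r i) x * ln (s (r i) x) - s (r i) x + 1) \<partial>M) \<le> ennreal (m + e)"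
      if "i \<ge> N" for i
    proof -
      have "0 \<le> s (r i) x * ln (s (r i) x) - s (r i) x + 1" for x
        using mult_ln_ge_minus_one[OF sd'(2)[of "r i" x]] by simp
      then have "(\<integral>\<^sup>+x. ennreal (s (r i) x * ln (s (r i) x) - s (r i) x + 1) \<partial>M)
          = ennreal (\<integral>x. s (r i) x * ln (s (r i) x) - s (r i) x + 1 \<partial>M)"
        using sd sd' by (intro nn_integral_eq_integral) auto
      also have "(\<integral>x. s (r i) x * ln (s (r i) x) - s (r i) x + 1 \<partial>M) = ent (s (r i))"
        using sd sd' by (simp add: prob_space)
      also have "\<dots> \<le> m + e"
      proof -
        have "1 / e < real (Suc (r i))" using N that seq_suble[OF r, of i] by simp
        then have "1 / real (Suc (r i)) < e"
          using \<open>e > 0\<close> by (simp add: field_simps del: of_nat_Suc)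
        then show ?thesis using s_lt[of "r i"] by simp
      qed
      finally show ?thesis by (simp add: ennreal_leI)
    qed
    then show "eventually (\<lambda>i. (\<integral>\<^sup>+x. ennreal (s (r i) x * ln (s (r i) x) - s (r i) x + 1) \<partial>M)
        \<le> ennreal (m + e)) sequentially"
      unfolding eventually_sequentially by blast
  qed measurable
  have gap_nn: "0 \<le> f x * ln (f x) - f x + 1" for x
    using mult_ln_ge_minus_one[OF nn[of x]] by simp
  have int_gap: "integrable M (\<lambda>x. f x * ln (f x) - f x + 1)"
    using ent_f[of 1] gap_nn by (intro integrableI_nonneg) (auto simp: le_less_trans)
  have "integrable M (\<lambda>x. f x - 1)" using int_f by simp
  from Bochner_Integration.integrable_add[OF int_gap this]
  have "integrable M (\<lambda>x. (f x * ln (f x) - f x + 1) + (f x - 1))" .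
  moreover have "(\<lambda>x. (f x * ln (f x) - f x + 1) + (f x - 1)) = (\<lambda>x. f x * ln (f x))" by auto
  ultimately have int_ent: "integrable M (\<lambda>x. f x * ln (f x))" by metis
  have "ent f \<le> m + e" if "e > 0" for e :: real
  proof -
    have "ennreal (ent f) = ennreal (\<integral>x. f x * ln (f x) - f x + 1 \<partial>M)"
      using int_ent int_f f by (simp add: prob_space prob_density_onD(4))
    also have "\<dots> = (\<integral>\<^sup>+x. ennreal (f x * ln (f x) - f x + 1) \<partial>M)"
      using int_gap gap_nn by (intro nn_integral_eq_integral[symmetric]) auto
    also have "\<dots> \<le> ennreal (m + e)" by (rule ent_f[OF that])
    finally show ?thesis
      using m_nonneg that by (simp add: ennreal_le_iff del: ennreal_plus)
  qed
  then have "ent f \<le> m" by (rule field_le_epsilon)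
  moreover have "f \<in> ?F"
    using f int_ent cstr by (auto simp: finite_entropy_densities_def)
  ultimately show ?thesis using m_le by (intro that[of f]) (auto intro: order_trans)
qed

text \<open>The midpoint of two minimisers is a competitor, so the entropy gap is at most 0; the L1
  distance is then at most every \<open>e > 0\<close>.\<close>

lemma entropy_minimiser_AE_unique:
  assumes K: "\<And>E c. (E, c) \<in> K \<Longrightarrow> E \<in> events"
    and f: "f \<in> finite_entropy_densities M K" and g: "g \<in> finite_entropy_densities M K"
    and min: "\<And>h. h \<in> finite_entropy_densities M K \<Longrightarrow> ent f \<le> ent h"
    and eq: "ent f = ent g"
  shows "AE x in M. f x = g x"
proof -
  have fd: "integrable M f" and gd: "integrable M g"
    using f g by (auto simp: finite_entropy_densities_def prob_density_on_def)
  have gap: "(ent f + ent g) / 2 - ent (\<lambda>x. (f x + g x) / 2) \<le> 0"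
    using min[OF midpoint_in_finite_entropy_densities[OF K f g]] eq by simp
  have "(\<integral>x. \<bar>f x - g x\<bar> \<partial>M) \<le> 0 + e" if "e > 0" for e :: real
  proof -
    have "(\<integral>x. \<bar>f x - g x\<bar> \<partial>M) \<le> 2 * (e / 2)
        + 2 / (e / 2) * ((ent f + ent g) / 2 - ent (\<lambda>x. (f x + g x) / 2))"
      using that by (intro L1_dist_le_entropy_gap[OF K f g]) auto
    also have "\<dots> \<le> 2 * (e / 2) + 2 / (e / 2) * 0"
      using gap that by (intro add_left_mono mult_left_mono) auto
    finally show ?thesis by simp
  qed
  then have "(\<integral>x. \<bar>f x - g x\<bar> \<partial>M) \<le> 0" by (rule field_le_epsilon)
  then have "(\<integral>x. \<bar>f x - g x\<bar> \<partial>M) = 0" by (intro antisym integral_nonneg_AE) auto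
  then show ?thesis
    using fd gd by (subst (asm) integral_nonneg_eq_0_iff_AE) auto
qed

section \<open>From densities back to probability measures\<close>

lemma measure_density_eq_integral:
  assumes "prob_density_on M f" "E \<in> events"
  shows "measure (density M f) E = (\<integral>x. indicator E x * f x \<partial>M)"
proof -
  note f = prob_density_onD[OF assms(1)]
  note [measurable] = f(1) assms(2)
  have "emeasure (density M f) E = (\<integral>\<^sup>+x. ennreal (indicator E x * f x) \<partial>M)"
    by (subst emeasure_density) (auto intro!: nn_integral_cong split: split_indicator)
  also have "\<dots> = ennreal (\<integral>x. indicator E x * f x \<partial>M)"
    using f(2) integrable_mult_indicator[OF assms(2) f(3)]
    by (intro nn_integral_eq_integral) auto
  finally show ?thesis
    using f(2) by (simp add: measure_def integral_nonneg_AE)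
qed

text \<open>The pairs \<open>(E, c)\<close> prescribe the measure \<open>c\<close> of the event \<open>E\<close>; marginal constraints have this form.\<close>

theorem unique_entropy_projection:
  assumes K: "\<And>E c. (E, c) \<in> K \<Longrightarrow> E \<in> events"
    and adm: "\<And>P. adm P \<longleftrightarrow>
      prob_space P \<and> sets P = events \<and> (\<forall>(E, c)\<in>K. measure P E = c)"
    and P0: "adm P0" "rel_entropy P0 M < \<infinity>"
  shows "\<exists>!P. adm P \<and> rel_entropy P M < \<infinity> \<and> (\<forall>Q. adm Q \<longrightarrow> rel_entropy P M \<le> rel_entropy Q M)"
proof -
  let ?F = "finite_entropy_densities M K"
  \<comment> \<open>Together \<open>F\<close> and \<open>F'\<close> identify the admissible laws of
    finite entropy with the densities in \<open>?F\<close>, so that the minimisation can be carried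
    out among functions.\<close>
  have F: "\<exists>f\<in>?F. P = density M f \<and> rel_entropy P M = ereal (ent f)"
    if P: "adm P" "rel_entropy P M < \<infinity>" for P
  proof -
    obtain f where f: "prob_density_on M f" "P = density M f" "integrable M (\<lambda>x. f x * ln (f x))"
        "rel_entropy P M = ereal (ent f)"
      using P finite_rel_entropyE[of P] by (auto simp: adm)
    have "f \<in> ?F"
      using P(1) f K measure_density_eq_integral[OF f(1)]
      by (fastforce simp: finite_entropy_densities_def adm)
    then show ?thesis using f by blast
  qed
  have F': "adm (density M f)" "rel_entropy (density M f) M = ereal (ent f)" if f: "f \<in> ?F" for f
  proof -
    have fd: "prob_density_on M f" and fi: "integrable M (\<lambda>x. f x * ln (f x))"
      using f by (auto simp: finite_entropy_densities_def)
    have "prob_space (density M f)"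
      using fd prob_density_on_iff[of f M] prob_density_onD[OF fd] by blast
    then show "adm (density M f)"
      using f K measure_density_eq_integral[OF fd]
      by (auto simp: finite_entropy_densities_def adm)
    show "rel_entropy (density M f) M = ereal (ent f)"
      using rel_entropy_density[OF fd] fi by simp
  qed
  obtain f where f: "f \<in> ?F" "\<And>g. g \<in> ?F \<Longrightarrow> ent f \<le> ent g"
    using entropy_minimiser_exists[of K] K F[OF P0] by blast
  show ?thesis
  proof (intro ex1I[of _ "density M f"] conjI allI impI)
    show "adm (density M f)" "rel_entropy (density M f) M < \<infinity>"
      using F'[OF f(1)] by auto
    show "rel_entropy (density M f) M \<le> rel_entropy Q M" if "adm Q" for Q
    proof (cases "rel_entropy Q M < \<infinity>")
      case True
      then show ?thesis using F[OF that] f F'[OF f(1)] by auto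
    qed auto
  next
    fix P assume P: "adm P \<and> rel_entropy P M < \<infinity> \<and> (\<forall>Q. adm Q \<longrightarrow> rel_entropy P M \<le> rel_entropy Q M)"
    then obtain g where g: "g \<in> ?F" "P = density M g" "rel_entropy P M = ereal (ent g)"
      using F by blast
    have "ent g \<le> ent f" using P g F'[OF f(1)] by (metis ereal_less_eq(3))
    then have "AE x in M. f x = g x"
      using f g K by (intro entropy_minimiser_AE_unique[of K]) (auto intro: antisym)
    \<comment> \<open>Densities that agree almost everywhere define the same measure, which makes
      the law unique although its density is not.\<close>
    then show "P = density M f"
      using f(1) g(1) unfolding g(2)
      by (intro density_cong) (auto simp: finite_entropy_densities_def prob_density_on_def)
  qed
qed

text \<open>
  Only finiteness is needed, so conditional Jensen is avoided: with \<open>g\<close> the density of the image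
  law and \<open>w = max 1 g\<close>, pointwise \<open>0 \<le> f ln (w \<circ> T) \<le> f ln f - f + w \<circ> T\<close>.
\<close>

theorem finite_rel_entropy_distr:
  assumes T[measurable]: "T \<in> measurable M N"
    and P: "prob_space P" "sets P = sets M" "rel_entropy P M < \<infinity>"
  shows "rel_entropy (distr P N T) (distr M N T) < \<infinity>"
proof -
  obtain f where f: "prob_density_on M f" "P = density M f" "integrable M (\<lambda>x. f x * ln (f x))"
    using finite_rel_entropyE[OF P] by metis
  note fd = prob_density_onD[OF f(1)]
  note [measurable] = fd(1)
  have T'[measurable]: "T \<in> measurable P N" using T P(2) by (simp cong: measurable_cong_sets)
  interpret D: prob_space "distr M N T" by (rule prob_space_distr[OF T])
  interpret Q: prob_space "distr P N T" by (rule prob_space.prob_space_distr[OF P(1) T'])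
  have ac: "absolutely_continuous (distr M N T) (distr P N T)"
    unfolding absolutely_continuous_def
  proof
    fix A assume "A \<in> null_sets (distr M N T)"
    then have A: "A \<in> sets N" "T -` A \<inter> space M \<in> null_sets M"
      by (auto simp: null_sets_distr_iff)
    have "T -` A \<inter> space M \<in> null_sets P"
      using A(2) absolutely_continuousI_density[of "\<lambda>x. ennreal (f x)" M] f(2)
      by (auto simp: absolutely_continuous_def)
    then show "A \<in> null_sets (distr P N T)"
      using A(1) sets_eq_imp_space_eq[OF P(2)] by (auto simp: null_sets_distr_iff)
  qed
  define g where "g y = enn2real (RN_deriv (distr M N T) (distr P N T) y)" for y
  have [measurable]: "g \<in> borel_measurable N" and g_nonneg: "\<And>y. 0 \<le> g y"
    using borel_measurable_RN_deriv[of "distr M N T" "distr P N T"] by (simp_all add: g_def[abs_def])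
  have "AE y in distr M N T. RN_deriv (distr M N T) (distr P N T) y \<noteq> \<infinity>"
    by (intro D.RN_deriv_finite Q.sigma_finite_measure_axioms ac) simp
  then have "density (distr M N T) (\<lambda>y. ennreal (g y)) = density (distr M N T) (RN_deriv (distr M N T) (distr P N T))"
    by (intro density_cong) (auto simp: g_def less_top)
  then have Q: "distr P N T = density (distr M N T) g"
    using D.density_RN_deriv[OF ac] by simp
  have gd: "prob_density_on (distr M N T) g"
    using Q.prob_space_axioms g_nonneg by (subst prob_density_on_iff) (auto simp flip: Q)
  note gd' = prob_density_onD[OF gd]
  \<comment> \<open>The truncation at 1 makes \<open>ln w\<close> nonnegative and keeps
    \<open>w\<close> integrable, since \<open>w <= 1 + g\<close>.\<close>
  define w where "w y = max 1 (g y)" for y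
  have [measurable]: "w \<in> borel_measurable N" unfolding w_def[abs_def] by measurable
  have int_w: "integrable M (\<lambda>x. w (T x))"
    using gd'(3) by (simp add: w_def integrable_distr_eq)
  have int_f_ln_w: "integrable M (\<lambda>x. f x * ln (w (T x)))"
  proof (rule Bochner_Integration.integrable_bound)
    show "integrable M (\<lambda>x. f x * ln (f x) - f x + w (T x))"
      using f(3) fd(3) int_w by simp
    show "AE x in M. norm (f x * ln (w (T x))) \<le> norm (f x * ln (f x) - f x + w (T x))"
    proof (rule AE_I2)
      fix x
      have w: "1 \<le> w (T x)" by (simp add: w_def)
      have "f x - w (T x) \<le> f x * (ln (f x) - ln (w (T x)))"
        using mult_ln_div_ge[OF fd(2)[of x], of "w (T x)"] w
          zero_le_power2[of "sqrt (f x) - sqrt (w (T x))"] by linarith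
      then have "f x * ln (w (T x)) \<le> f x * ln (f x) - f x + w (T x)"
        by (simp add: right_diff_distrib)
      moreover have "0 \<le> f x * ln (w (T x))" using fd(2)[of x] w by simp
      ultimately show "norm (f x * ln (w (T x))) \<le> norm (f x * ln (f x) - f x + w (T x))"
        by simp
    qed
  qed measurable
  \<comment> \<open>Integrating against \<open>f\<close> is integrating under \<open>P\<close>, and
    \<open>w\<close> composed with \<open>T\<close> becomes \<open>w\<close> under the image law,
    which has density \<open>g\<close>. So the bound descends to \<open>g ln w\<close>.\<close>
  then have "integrable P (\<lambda>x. ln (w (T x)))"
    using fd(2) by (simp add: f(2) integrable_density)
  then have "integrable (distr P N T) (\<lambda>y. ln (w y))"
    by (simp add: integrable_distr_eq)
  then have int_g_ln_w: "integrable (distr M N T) (\<lambda>y. g y * ln (w y))"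
    using g_nonneg unfolding Q by (simp add: integrable_density)
  \<comment> \<open>Where \<open>g >= 1\<close> one has \<open>w = g\<close>; where
    \<open>g < 1\<close>, \<open>g ln g\<close> lies between -1 and 0.\<close>
  have "integrable (distr M N T) (\<lambda>y. g y * ln (g y))"
  proof (rule Bochner_Integration.integrable_bound)
    show "integrable (distr M N T) (\<lambda>y. g y * ln (w y) + g y + 1)"
      using int_g_ln_w gd'(3) by simp
    show "AE y in distr M N T. norm (g y * ln (g y)) \<le> norm (g y * ln (w y) + g y + 1)"
    proof (rule AE_I2)
      fix y
      show "norm (g y * ln (g y)) \<le> norm (g y * ln (w y) + g y + 1)"
      proof (cases "1 \<le> g y")
        case True
        then show ?thesis by (simp add: w_def)
      next
        case False
        \<comment> \<open>The default \<open>ln 0 = 0\<close> lets the sign of the logarithm be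
          asserted also where \<open>g\<close> vanishes.\<close>
        then have "w y = 1" "ln (g y) \<le> 0" using g_nonneg[of y]
          by (auto simp: w_def ln_le_zero_iff) (metis ln_le_zero_iff ln_0 order_le_less order_less_imp_le not_le)
        then show ?thesis
          using mult_ln_ge_minus_one[OF g_nonneg[of y]] g_nonneg[of y]
            mult_nonneg_nonpos[OF g_nonneg[of y] \<open>ln (g y) \<le> 0\<close>] by simp
      qed
    qed
  qed measurable
  then show ?thesis
    using D.rel_entropy_density[OF gd] unfolding Q by simp
qed

end

subsection \<open>Gaussian densities\<close>

text \<open>The parameter \<open>v\<close> is the variance. The form through the norm, equal to the
  product form by \<open>gauss_eq_prod\<close>, lets squares be completed with inner
  products.\<close>

definition gauss :: "real \<Rightarrow> real ^ 'n \<Rightarrow> real" where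
  "gauss v x = (1 / sqrt (2 * pi * v)) ^ CARD('n) * exp (- (norm x)\<^sup>2 / (2 * v))"

lemma gauss_eq_prod:
  fixes x :: "real ^ 'n"
  assumes "v > 0"
  shows "gauss v x = (\<Prod>i\<in>UNIV. normal_density 0 (sqrt v) (x $ i))"
proof -
  have "(\<Prod>i\<in>UNIV. normal_density 0 (sqrt v) (x $ i))
      = (1 / sqrt (2 * pi * v)) ^ CARD('n) * (\<Prod>i\<in>UNIV. exp (- (x $ i)\<^sup>2 / (2 * v)))"
    using assms by (simp add: normal_density_def prod.distrib prod_dividef power_divide)
  also have "(\<Prod>i\<in>UNIV. exp (- (x $ i)\<^sup>2 / (2 * v))) = exp (- (norm x)\<^sup>2 / (2 * v))"
  proof -
    have "(norm x)\<^sup>2 = (\<Sum>i\<in>UNIV. (x $ i)\<^sup>2)"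
      unfolding power2_norm_eq_inner inner_vec_def by (simp add: power2_eq_square)
    then show ?thesis by (simp add: exp_sum[symmetric] sum_negf sum_divide_distrib)
  qed
  finally show ?thesis by (simp add: gauss_def)
qed

lemma centred_gaussian_eq:
  "v > 0 \<Longrightarrow> centred_gaussian v = density lborel (\<lambda>x. ennreal (gauss v x))"
  by (simp add: centred_gaussian_def gauss_eq_prod)

lemma gauss_pos: "v > 0 \<Longrightarrow> gauss v x > 0"
  by (simp add: gauss_def)

lemma gauss_nonneg [simp]: "0 \<le> v \<Longrightarrow> 0 \<le> gauss v x"
  by (simp add: gauss_def)

lemma borel_measurable_gauss [measurable]: "gauss v \<in> borel_measurable borel"
  unfolding gauss_def[abs_def] by measurable

text \<open>Both sides are the joint density of a Gaussian pair: \<open>x\<close> of variance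
  \<open>v\<close>, and \<open>a\<close> equal to \<open>c x\<close> plus independent noise of
  variance \<open>w\<close>. The right side disintegrates the other way, as the law of
  \<open>a\<close> times the conditional law of \<open>x\<close> given \<open>a\<close>.\<close>

lemma gauss_mult_gauss:
  fixes x a :: "real ^ 'n"
  assumes "v > 0" "w > 0"
  shows "gauss v x * gauss w (a - c *\<^sub>R x) =
    gauss (w + c\<^sup>2 * v) a * gauss (v * w / (w + c\<^sup>2 * v)) (x - (c * v / (w + c\<^sup>2 * v)) *\<^sub>R a)"
proof -
  define D where "D = w + c\<^sup>2 * v"
  have D: "D > 0" using assms by (simp add: D_def add_pos_nonneg)
  \<comment> \<open>The normalising constants agree because the two variances have the same product
    on both sides: \<open>v * w = D * (v * w / D)\<close>.\<close>
  have "(1 / sqrt (2 * pi * v)) * (1 / sqrt (2 * pi * w))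
      = (1 / sqrt (2 * pi * D)) * (1 / sqrt (2 * pi * (v * w / D)))"
  proof -
    have "(2 * pi * v) * (2 * pi * w) = (2 * pi * D) * (2 * pi * (v * w / D))"
      using D by simp
    moreover have "1 / sqrt p * (1 / sqrt q) = 1 / sqrt (p * q)" for p q :: real
      by (simp add: real_sqrt_mult)
    ultimately show ?thesis by metis
  qed
  then have c: "(1 / sqrt (2 * pi * v)) ^ CARD('n) * (1 / sqrt (2 * pi * w)) ^ CARD('n)
      = (1 / sqrt (2 * pi * D)) ^ CARD('n) * (1 / sqrt (2 * pi * (v * w / D))) ^ CARD('n)"
    by (metis power_mult_distrib)
  define X A Z where "X = x \<bullet> x" and "A = a \<bullet> a" and "Z = x \<bullet> a"
  have n: "(norm x)\<^sup>2 = X" "(norm a)\<^sup>2 = A"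
      "(norm (a - c *\<^sub>R x))\<^sup>2 = A - 2 * c * Z + c\<^sup>2 * X"
      "(norm (x - (c * v / D) *\<^sub>R a))\<^sup>2 = X - 2 * (c * v / D) * Z + (c * v / D)\<^sup>2 * A"
    unfolding power2_norm_eq_inner X_def A_def Z_def inner_diff_left inner_diff_right
    by (simp_all add: inner_commute[of a x] power2_eq_square algebra_simps)
  \<comment> \<open>The exponents are compared coefficient by coefficient: fact \<open>1\<close>
    treats \<open>X\<close>, fact \<open>2\<close> the mixed term \<open>Z\<close>, and the
    remaining chain \<open>A\<close>.\<close>
  have "X / (2 * v) + (A - 2 * c * Z + c\<^sup>2 * X) / (2 * w)
      = A / (2 * D) + (X - 2 * (c * v / D) * Z + (c * v / D)\<^sup>2 * A) / (2 * (v * w / D))"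
  proof -
    have "X / (2 * v) + c\<^sup>2 * X / (2 * w) = X * (w + c\<^sup>2 * v) / (2 * (v * w))"
      using assms by (simp add: field_simps)
    then have "X / (2 * v) + c\<^sup>2 * X / (2 * w) = X / (2 * (v * w / D))"
      unfolding D_def[symmetric] using D assms by simp
    note 1 = this
    have 2: "2 * c * Z / (2 * w) = 2 * (c * v / D) * Z / (2 * (v * w / D))"
      using assms D by simp
    have "(c * v / D)\<^sup>2 * A / (2 * (v * w / D)) = A * (c\<^sup>2 * v) / (2 * D * w)"
      using assms D by (simp add: power2_eq_square mult_ac)
    moreover have "A / (2 * D) + A * (c\<^sup>2 * v) / (2 * D * w) = A * (w + c\<^sup>2 * v) / (2 * D * w)"
      using assms D by (simp add: field_simps)
    moreover have "A * (w + c\<^sup>2 * v) / (2 * D * w) = A / (2 * w)"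
      unfolding D_def[symmetric] using D by simp
    ultimately have "A / (2 * w) = A / (2 * D) + (c * v / D)\<^sup>2 * A / (2 * (v * w / D))"
      by metis
    moreover have "p + q = r \<Longrightarrow> k = l + m \<Longrightarrow> s = s' \<Longrightarrow> p + (k - s + q) = l + (r - s' + m)"
      for p q r s s' k l m :: real by simp
    ultimately show ?thesis
      unfolding add_divide_distrib diff_divide_distrib using 1 2 by blast
  qed
  note eq = this
  have 3: "exp (- X / (2 * v)) * exp (- (A - 2 * c * Z + c\<^sup>2 * X) / (2 * w))
      = exp (- A / (2 * D)) * exp (- (X - 2 * (c * v / D) * Z + (c * v / D)\<^sup>2 * A) / (2 * (v * w / D)))"
  proof -
    have "p + q = r + s \<Longrightarrow> exp (- p) * exp (- q) = exp (- r) * exp (- s)" for p q r s :: real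
      by (metis exp_add minus_add_distrib)
    from this[OF eq] show ?thesis unfolding minus_divide_left .
  qed
  show ?thesis
    unfolding D_def[symmetric] gauss_def n using arg_cong2[OF c 3, of "(*)"]
    by (simp only: mult_ac)
qed

section \<open>Convolution and second moments of Gaussian densities\<close>

lemma nn_integral_lborel_diff:
  fixes c :: "'a :: euclidean_space"
  assumes [measurable]: "F \<in> borel_measurable borel"
  shows "(\<integral>\<^sup>+x. F (x - c) \<partial>lborel) = (\<integral>\<^sup>+x. F x \<partial>lborel)"
proof -
  have "(\<integral>\<^sup>+x. F x \<partial>lborel) = (\<integral>\<^sup>+x. F x \<partial>distr lborel borel ((+) (- c)))"
    by (simp add: lborel_distr_plus)
  also have "\<dots> = (\<integral>\<^sup>+x. F (x - c) \<partial>lborel)"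
    by (subst nn_integral_distr) auto
  finally show ?thesis ..
qed

lemma nn_integral_gauss:
  assumes v: "v > 0"
  shows "(\<integral>\<^sup>+x. ennreal (gauss v (x :: real ^ 'n)) \<partial>lborel) = 1"
proof -
  have 1: "(\<integral>\<^sup>+x. ennreal (normal_density 0 (sqrt v) x) \<partial>lborel) = 1"
    using v by (subst nn_integral_eq_integral) auto
  have "gauss v x = (\<Prod>b\<in>Basis. normal_density 0 (sqrt v) (x \<bullet> b))" for x :: "real ^ 'n"
  proof -
    have B: "Basis = (\<lambda>i. axis i (1::real)) ` (UNIV :: 'n set)"
      by (auto simp: Basis_vec_def)
    have "inj (\<lambda>i. axis i (1::real) :: real ^ 'n)"
      by (auto simp: inj_on_def axis_eq_axis)
    then show ?thesis
      using v by (simp add: gauss_eq_prod B prod.reindex inner_axis)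
  qed
  then have "(\<integral>\<^sup>+x. ennreal (gauss v (x :: real ^ 'n)) \<partial>lborel)
      = (\<integral>\<^sup>+x. (\<Prod>b\<in>Basis. ennreal (normal_density 0 (sqrt v) ((x :: real ^ 'n) \<bullet> b))) \<partial>lborel)"
    by (simp add: prod_ennreal)
  also have "\<dots> = 1"
    by (subst nn_integral_lborel_prod) (auto simp: 1)
  finally show ?thesis .
qed

lemma prob_space_centred_gaussian:
  "v > 0 \<Longrightarrow> prob_space (centred_gaussian v)"
  by (auto simp: centred_gaussian_eq emeasure_density nn_integral_gauss intro!: prob_spaceI)

text \<open>By \<open>gauss_mult_gauss\<close> the conditional density of \<open>x\<close> given
  \<open>a\<close> splits off and integrates to 1, leaving the law of \<open>a\<close>.\<close>

lemma nn_integral_gauss_convolution: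
  fixes a :: "real ^ 'n"
  assumes v: "v > 0" and w: "w > 0"
  shows "(\<integral>\<^sup>+x. ennreal (gauss v x) * ennreal (gauss w (a - c *\<^sub>R x)) \<partial>lborel)
    = ennreal (gauss (w + c\<^sup>2 * v) a)"
proof -
  have D: "w + c\<^sup>2 * v > 0" "v * w / (w + c\<^sup>2 * v) > 0"
    using v w by (auto simp: add_pos_nonneg)
  have "(\<integral>\<^sup>+x. ennreal (gauss v x) * ennreal (gauss w (a - c *\<^sub>R x)) \<partial>lborel)
     = (\<integral>\<^sup>+x. ennreal (gauss (w + c\<^sup>2 * v) a) * ennreal (gauss (v * w / (w + c\<^sup>2 * v))
          (x - (c * v / (w + c\<^sup>2 * v)) *\<^sub>R a)) \<partial>lborel)"
    using v w D by (intro nn_integral_cong) (simp add: ennreal_mult[symmetric] gauss_mult_gauss less_imp_le)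
  also have "\<dots> = ennreal (gauss (w + c\<^sup>2 * v) a) * (\<integral>\<^sup>+x. ennreal (gauss (v * w / (w + c\<^sup>2 * v))
          (x - (c * v / (w + c\<^sup>2 * v)) *\<^sub>R a)) \<partial>lborel)"
    by (intro nn_integral_cmult) measurable
  also have "\<dots> = ennreal (gauss (w + c\<^sup>2 * v) a)"
    using D(2) by (subst nn_integral_lborel_diff[of "\<lambda>x. ennreal (gauss _ x)"]) (auto simp: nn_integral_gauss)
  finally show ?thesis .
qed

text \<open>Half of the exponent absorbs the square: with \<open>s = |x|^2 / (4 v)\<close> one has
  \<open>s exp (- s) <= 1\<close>, and the other half is a Gaussian of variance \<open>2 v\<close>.
  The constant collects \<open>4 v\<close> and the ratio of the normalisations, a power of
  \<open>sqrt 2\<close>.\<close>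

lemma gauss_second_moment_finite:
  assumes v: "v > 0"
  shows "(\<integral>\<^sup>+x. ennreal ((norm x)\<^sup>2) \<partial>(centred_gaussian v :: (real ^ 'n) measure)) < \<infinity>"
proof -
  let ?C = "4 * v * (sqrt 2) ^ CARD('n)"
  have le: "gauss v x * (norm x)\<^sup>2 \<le> ?C * gauss (2 * v) x" for x :: "real ^ 'n"
  proof -
    define s where "s = (norm x)\<^sup>2 / (4 * v)"
    have n: "(norm x)\<^sup>2 = 4 * v * s" using v by (simp add: s_def)
    have e: "exp (- (norm x)\<^sup>2 / (2 * v)) = exp (- s) * exp (- s)"
      "exp (- (norm x)\<^sup>2 / (2 * (2 * v))) = exp (- s)"
    proof -
      have "- (norm x)\<^sup>2 / (2 * v) = - s + - s" "- (norm x)\<^sup>2 / (2 * (2 * v)) = - s"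
        using v unfolding n by simp_all
      then show "exp (- (norm x)\<^sup>2 / (2 * v)) = exp (- s) * exp (- s)"
        "exp (- (norm x)\<^sup>2 / (2 * (2 * v))) = exp (- s)"
        by (simp_all only: exp_add)
    qed
    have "s \<le> exp s" using exp_ge_add_one_self[of s] by linarith
    then have "exp (- s) * s \<le> exp (- s) * exp s" by (intro mult_left_mono) auto
    then have s: "exp (- s) * s \<le> 1" by (simp add: exp_add[symmetric])
    have c: "(1 / sqrt (2 * pi * v)) ^ CARD('n) = (sqrt 2) ^ CARD('n) * (1 / sqrt (2 * pi * (2 * v))) ^ CARD('n)"
    proof -
      have "1 / sqrt (2 * pi * v) = sqrt 2 * (1 / sqrt (2 * pi * (2 * v)))"
        using v by (simp add: real_sqrt_mult field_simps)
      then show ?thesis by (simp only: power_mult_distrib)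
    qed
    have "gauss v x * (norm x)\<^sup>2 = (1 / sqrt (2 * pi * v)) ^ CARD('n) * exp (- s) * (4 * v) * (exp (- s) * s)"
      unfolding gauss_def e by (simp only: n mult_ac)
    also have "\<dots> \<le> (1 / sqrt (2 * pi * v)) ^ CARD('n) * exp (- s) * (4 * v) * 1"
      using v s by (intro mult_left_mono) auto
    also have "\<dots> = ?C * gauss (2 * v) x"
      unfolding gauss_def e c by (simp add: mult_ac)
    finally show ?thesis .
  qed
  have "(\<integral>\<^sup>+x. ennreal ((norm x)\<^sup>2) \<partial>(centred_gaussian v :: (real ^ 'n) measure))
      = (\<integral>\<^sup>+x. ennreal (gauss v x) * ennreal ((norm (x :: real ^ 'n))\<^sup>2) \<partial>lborel)"
    using v by (simp add: centred_gaussian_eq nn_integral_density)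
  also have "\<dots> \<le> (\<integral>\<^sup>+x. ennreal ?C * ennreal (gauss (2 * v) (x :: real ^ 'n)) \<partial>lborel)"
    using v le by (intro nn_integral_mono) (simp add: ennreal_mult[symmetric] ennreal_leI)
  also have "\<dots> = ennreal ?C"
    using v by (subst nn_integral_cmult) (auto simp: nn_integral_gauss)
  finally show ?thesis by (simp add: le_less_trans)
qed

subsection \<open>Finite-dimensional laws of Brownian motion\<close>

lemma measurable_path_eval [measurable]:
  fixes P :: "(real \<Rightarrow> real ^ 'n) measure"
  assumes "sets P = sets path_space" "t \<in> {0..1}"
  shows "(\<lambda>\<omega>. \<omega> t) \<in> borel_measurable P"
proof -
  have "(\<lambda>\<omega>. \<omega> t) \<in> borel_measurable (path_space :: (real \<Rightarrow> real ^ 'n) measure)"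
    unfolding path_space_def using assms(2)
    by (intro measurable_restrict_space1 measurable_component_singleton)
  then show ?thesis using assms(1) by (simp cong: measurable_cong_sets)
qed

lemma measurable_path_restrict:
  fixes P :: "(real \<Rightarrow> real ^ 'n) measure"
  assumes "sets P = sets path_space" "s \<le> 1"
  shows "(\<lambda>\<omega>. restrict \<omega> {0..s}) \<in> measurable P (\<Pi>\<^sub>M r\<in>{0..s}. borel)"
proof -
  have "(\<lambda>\<omega>. restrict \<omega> {0..s}) \<in>
      measurable (path_space :: (real \<Rightarrow> real ^ 'n) measure) (\<Pi>\<^sub>M r\<in>{0..s}. borel)"
    unfolding path_space_def using assms(2)
    by (intro measurable_restrict_space1 measurable_restrict_subset) auto
  then show ?thesis using assms(1) by (simp cong: measurable_cong_sets)
qed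

text \<open>Rectangles pull back to intersections of independent events. This turns independence of
  generated sigma-algebras, as stated in \<open>brownian_law\<close>, into a product law on which
  Fubini's theorem can act.\<close>

lemma (in prob_space) distr_pair_eq_of_indep_set:
  assumes X[measurable]: "X \<in> measurable M N" and Y[measurable]: "Y \<in> measurable M L"
    and indep: "indep_set (sets (vimage_algebra (space M) X N)) (sets (vimage_algebra (space M) Y L))"
  shows "distr M N X \<Otimes>\<^sub>M distr M L Y = distr M (N \<Otimes>\<^sub>M L) (\<lambda>\<omega>. (X \<omega>, Y \<omega>))"
proof (rule pair_measure_eqI)
  show "sigma_finite_measure (distr M N X)" "sigma_finite_measure (distr M L Y)"
    using prob_space_distr[OF X] prob_space_distr[OF Y] prob_space_imp_sigma_finite by blast+
  fix A B assume "A \<in> sets (distr M N X)" "B \<in> sets (distr M L Y)"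
  then have [measurable]: "A \<in> sets N" "B \<in> sets L" by auto
  have "prob ((X -` A \<inter> space M) \<inter> (Y -` B \<inter> space M)) = prob (X -` A \<inter> space M) * prob (Y -` B \<inter> space M)"
    by (intro indep_setD[OF indep] in_vimage_algebra) auto
  moreover have "(\<lambda>\<omega>. (X \<omega>, Y \<omega>)) -` (A \<times> B) \<inter> space M = (X -` A \<inter> space M) \<inter> (Y -` B \<inter> space M)"
    by auto
  ultimately show "emeasure (distr M N X) A * emeasure (distr M L Y) B
      = emeasure (distr M (N \<Otimes>\<^sub>M L) (\<lambda>\<omega>. (X \<omega>, Y \<omega>))) (A \<times> B)"
    by (simp add: emeasure_distr emeasure_eq_measure ennreal_mult)
qed simp

section \<open>Markov property and integrals over two, three and four times\<close>

locale brownian_motion =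
  fixes chi :: "(real ^ 'n) measure" and R :: "(real \<Rightarrow> real ^ 'n) measure"
  assumes brownian: "brownian_law chi R"
begin

lemma sets_R [measurable_cong]: "sets R = sets path_space"
  using brownian by (simp add: brownian_law_def path_law_def)

sublocale prob_space R
  using brownian by (simp add: brownian_law_def path_law_def)

lemma measurable_eval [measurable]: "t \<in> {0..1} \<Longrightarrow> (\<lambda>\<omega>. \<omega> t) \<in> borel_measurable R"
  by (intro measurable_path_eval sets_R)

text \<open>The past up to \<open>s\<close> and the increment are independent, so their joint law is
  a product; Fubini's theorem and a translation by \<open>\<omega> s\<close> give the Gaussian
  kernel. As \<open>H\<close> may see the whole past, the formula can be iterated.\<close>

lemma nn_integral_markov:
  assumes st: "0 \<le> s" "s < t" "t \<le> 1"
    and H[measurable]: "H \<in> borel_measurable ((\<Pi>\<^sub>M r\<in>{0..s}. borel) \<Otimes>\<^sub>M borel)"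
  shows "(\<integral>\<^sup>+\<omega>. H (restrict \<omega> {0..s}, \<omega> t) \<partial>R) =
    (\<integral>\<^sup>+\<omega>. (\<integral>\<^sup>+a. ennreal (gauss (t - s) (a - \<omega> s)) * H (restrict \<omega> {0..s}, a) \<partial>lborel) \<partial>R)"
proof -
  let ?N = "\<Pi>\<^sub>M r\<in>{0..s}. (borel :: (real ^ 'n) measure)"
  let ?X = "\<lambda>\<omega>. restrict \<omega> {0..s}" and ?Y = "\<lambda>\<omega>. \<omega> t - \<omega> s"
  have X[measurable]: "?X \<in> measurable R ?N"
    using st by (intro measurable_path_restrict sets_R) auto
  have [measurable]: "(\<lambda>\<omega>. \<omega> t) \<in> borel_measurable R" "(\<lambda>\<omega>. \<omega> s) \<in> borel_measurable R"
    using st by auto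
  have [measurable]: "(\<lambda>p. p s) \<in> borel_measurable ?N"
    using st by (intro measurable_component_singleton) auto
  have Y: "?Y \<in> borel_measurable R" by measurable
  have dY: "distr R borel ?Y = density lborel (\<lambda>x. ennreal (gauss (t - s) x))"
    using brownian st by (auto simp: brownian_law_def centred_gaussian_eq)
  have joint: "distr R ?N ?X \<Otimes>\<^sub>M distr R borel ?Y = distr R (?N \<Otimes>\<^sub>M borel) (\<lambda>\<omega>. (?X \<omega>, ?Y \<omega>))"
    using brownian st X Y by (intro distr_pair_eq_of_indep_set) (auto simp: brownian_law_def)
  interpret Y: prob_space "distr R borel ?Y" by (rule prob_space_distr[OF Y])
  have "(\<integral>\<^sup>+\<omega>. H (?X \<omega>, \<omega> t) \<partial>R) = (\<integral>\<^sup>+\<omega>. (\<lambda>(p, d). H (p, p s + d)) (?X \<omega>, ?Y \<omega>) \<partial>R)"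
    using st by (intro nn_integral_cong) auto
  also have "\<dots> = (\<integral>\<^sup>+z. (\<lambda>(p, d). H (p, p s + d)) z \<partial>distr R (?N \<Otimes>\<^sub>M borel) (\<lambda>\<omega>. (?X \<omega>, ?Y \<omega>)))"
    by (intro nn_integral_distr[symmetric]) measurable
  also have "\<dots> = (\<integral>\<^sup>+p. (\<integral>\<^sup>+d. H (p, p s + d) \<partial>distr R borel ?Y) \<partial>distr R ?N ?X)"
    unfolding joint[symmetric]
    by (subst Y.nn_integral_fst[symmetric]) simp_all
  also have "\<dots> = (\<integral>\<^sup>+\<omega>. (\<integral>\<^sup>+d. H (?X \<omega>, ?X \<omega> s + d) \<partial>distr R borel ?Y) \<partial>R)"
    by (intro nn_integral_distr) measurable
  also have "\<dots> = (\<integral>\<^sup>+\<omega>. (\<integral>\<^sup>+a. ennreal (gauss (t - s) (a - \<omega> s)) * H (?X \<omega>, a) \<partial>lborel) \<partial>R)"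
  proof (rule nn_integral_cong)
    fix \<omega> assume w: "\<omega> \<in> space R"
    have [measurable]: "?X \<omega> \<in> space ?N" using measurable_space[OF X w] .
    have "(\<integral>\<^sup>+d. H (?X \<omega>, ?X \<omega> s + d) \<partial>distr R borel ?Y)
        = (\<integral>\<^sup>+d. ennreal (gauss (t - s) d) * H (?X \<omega>, \<omega> s + d) \<partial>lborel)"
      unfolding dY using st by (subst nn_integral_density) auto
    also have "\<dots> = (\<integral>\<^sup>+a. (\<lambda>d. ennreal (gauss (t - s) d) * H (?X \<omega>, \<omega> s + d)) (a - \<omega> s) \<partial>lborel)"
      by (rule nn_integral_lborel_diff[symmetric]) measurable
    finally show "(\<integral>\<^sup>+d. H (?X \<omega>, ?X \<omega> s + d) \<partial>distr R borel ?Y)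
        = (\<integral>\<^sup>+a. ennreal (gauss (t - s) (a - \<omega> s)) * H (?X \<omega>, a) \<partial>lborel)"
      by simp
  qed
  finally show ?thesis .
qed

lemma nn_integral_two_times:
  assumes [measurable]: "F \<in> borel_measurable (borel \<Otimes>\<^sub>M borel)"
  shows "(\<integral>\<^sup>+\<omega>. F (\<omega> 0, \<omega> 1) \<partial>R) =
    (\<integral>\<^sup>+\<omega>. (\<integral>\<^sup>+y. ennreal (gauss 1 (y - \<omega> 0)) * F (\<omega> 0, y) \<partial>lborel) \<partial>R)"
proof -
  have [measurable]: "(\<lambda>p. p 0) \<in> borel_measurable (\<Pi>\<^sub>M r\<in>{0..0::real}. (borel :: (real ^ 'n) measure))"
    by (intro measurable_component_singleton) auto
  show ?thesis
    using nn_integral_markov[of 0 1 "\<lambda>(p, a). F (p 0, a)"] by simp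
qed

text \<open>Times are removed from the last one backwards: integrating against the final kernel
  leaves a function \<open>G\<close> of the earlier times, to which
  \<open>nn_integral_markov\<close> applies again.\<close>

lemma nn_integral_three_times:
  assumes r: "0 < r" "r < 1"
    and [measurable]: "F \<in> borel_measurable (borel \<Otimes>\<^sub>M borel \<Otimes>\<^sub>M borel)"
  shows "(\<integral>\<^sup>+\<omega>. F (\<omega> 0, \<omega> r, \<omega> 1) \<partial>R) =
    (\<integral>\<^sup>+\<omega>. (\<integral>\<^sup>+a. (\<integral>\<^sup>+y. ennreal (gauss r (a - \<omega> 0)) * ennreal (gauss (1 - r) (y - a)) * F (\<omega> 0, a, y)
      \<partial>lborel) \<partial>lborel) \<partial>R)"
proof -
  have [measurable]: "(\<lambda>p. p 0) \<in> borel_measurable (\<Pi>\<^sub>M r\<in>{0..0::real}. (borel :: (real ^ 'n) measure))"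
    by (intro measurable_component_singleton) auto
  have [measurable]: "(\<lambda>p. p 0) \<in> borel_measurable (\<Pi>\<^sub>M r\<in>{0..r}. (borel :: (real ^ 'n) measure))"
    "(\<lambda>p. p r) \<in> borel_measurable (\<Pi>\<^sub>M r\<in>{0..r}. (borel :: (real ^ 'n) measure))"
    using r by (auto intro!: measurable_component_singleton)
  define G where "G = (\<lambda>(x, a). \<integral>\<^sup>+y. ennreal (gauss (1 - r) (y - a)) * F (x, a, y) \<partial>lborel)"
  have [measurable]: "G \<in> borel_measurable (borel \<Otimes>\<^sub>M borel)"
    unfolding G_def by measurable
  have "(\<integral>\<^sup>+\<omega>. F (\<omega> 0, \<omega> r, \<omega> 1) \<partial>R) = (\<integral>\<^sup>+\<omega>. G (\<omega> 0, \<omega> r) \<partial>R)"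
    using nn_integral_markov[of r 1 "\<lambda>(p, a). F (p 0, p r, a)"] r by (simp add: G_def)
  also have "\<dots> = (\<integral>\<^sup>+\<omega>. (\<integral>\<^sup>+a. ennreal (gauss r (a - \<omega> 0)) * G (\<omega> 0, a) \<partial>lborel) \<partial>R)"
    using nn_integral_markov[of 0 r "\<lambda>(p, a). G (p 0, a)"] r by simp
  also have "\<dots> = (\<integral>\<^sup>+\<omega>. (\<integral>\<^sup>+a. (\<integral>\<^sup>+y. ennreal (gauss r (a - \<omega> 0)) * ennreal (gauss (1 - r) (y - a)) * F (\<omega> 0, a, y)
      \<partial>lborel) \<partial>lborel) \<partial>R)"
    unfolding G_def split_conv by (intro nn_integral_cong, subst nn_integral_cmult[symmetric]) (auto simp: mult.assoc)
  finally show ?thesis .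
qed

lemma nn_integral_four_times:
  assumes r: "0 < r" "r < s" "s < 1"
    and [measurable]: "F \<in> borel_measurable (borel \<Otimes>\<^sub>M borel \<Otimes>\<^sub>M borel \<Otimes>\<^sub>M borel)"
  shows "(\<integral>\<^sup>+\<omega>. F (\<omega> 0, \<omega> r, \<omega> s, \<omega> 1) \<partial>R) =
    (\<integral>\<^sup>+\<omega>. (\<integral>\<^sup>+a. (\<integral>\<^sup>+b. (\<integral>\<^sup>+y. ennreal (gauss r (a - \<omega> 0)) * ennreal (gauss (s - r) (b - a)) *
      ennreal (gauss (1 - s) (y - b)) * F (\<omega> 0, a, b, y) \<partial>lborel) \<partial>lborel) \<partial>lborel) \<partial>R)"
proof -
  have [measurable]: "(\<lambda>p. p 0) \<in> borel_measurable (\<Pi>\<^sub>M r\<in>{0..0::real}. (borel :: (real ^ 'n) measure))"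
    by (intro measurable_component_singleton) auto
  have [measurable]: "(\<lambda>p. p 0) \<in> borel_measurable (\<Pi>\<^sub>M r\<in>{0..r}. (borel :: (real ^ 'n) measure))"
    "(\<lambda>p. p r) \<in> borel_measurable (\<Pi>\<^sub>M r\<in>{0..r}. (borel :: (real ^ 'n) measure))"
    "(\<lambda>p. p 0) \<in> borel_measurable (\<Pi>\<^sub>M r\<in>{0..s}. (borel :: (real ^ 'n) measure))"
    "(\<lambda>p. p r) \<in> borel_measurable (\<Pi>\<^sub>M r\<in>{0..s}. (borel :: (real ^ 'n) measure))"
    "(\<lambda>p. p s) \<in> borel_measurable (\<Pi>\<^sub>M r\<in>{0..s}. (borel :: (real ^ 'n) measure))"
    using r by (auto intro!: measurable_component_singleton)
  define G where "G = (\<lambda>(x, a, b). \<integral>\<^sup>+y. ennreal (gauss (1 - s) (y - b)) * F (x, a, b, y) \<partial>lborel)"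
  define G' where "G' = (\<lambda>(x, a). \<integral>\<^sup>+b. ennreal (gauss (s - r) (b - a)) * G (x, a, b) \<partial>lborel)"
  have [measurable]: "G \<in> borel_measurable (borel \<Otimes>\<^sub>M borel \<Otimes>\<^sub>M borel)"
    unfolding G_def by measurable
  have [measurable]: "G' \<in> borel_measurable (borel \<Otimes>\<^sub>M borel)"
    unfolding G'_def by measurable
  have "(\<integral>\<^sup>+\<omega>. F (\<omega> 0, \<omega> r, \<omega> s, \<omega> 1) \<partial>R) = (\<integral>\<^sup>+\<omega>. G (\<omega> 0, \<omega> r, \<omega> s) \<partial>R)"
    using nn_integral_markov[of s 1 "\<lambda>(p, a). F (p 0, p r, p s, a)"] r by (simp add: G_def)
  also have "\<dots> = (\<integral>\<^sup>+\<omega>. G' (\<omega> 0, \<omega> r) \<partial>R)"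
    using nn_integral_markov[of r s "\<lambda>(p, a). G (p 0, p r, a)"] r by (simp add: G'_def)
  also have "\<dots> = (\<integral>\<^sup>+\<omega>. (\<integral>\<^sup>+a. ennreal (gauss r (a - \<omega> 0)) * G' (\<omega> 0, a) \<partial>lborel) \<partial>R)"
    using nn_integral_markov[of 0 r "\<lambda>(p, a). G' (p 0, a)"] r by simp
  also have "\<dots> = (\<integral>\<^sup>+\<omega>. (\<integral>\<^sup>+a. (\<integral>\<^sup>+b. (\<integral>\<^sup>+y. ennreal (gauss r (a - \<omega> 0)) * ennreal (gauss (s - r) (b - a)) *
      ennreal (gauss (1 - s) (y - b)) * F (\<omega> 0, a, b, y) \<partial>lborel) \<partial>lborel) \<partial>lborel) \<partial>R)"
    unfolding G_def G'_def split_conv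
    by (simp add: nn_integral_cmult[symmetric] mult.assoc)
  finally show ?thesis .
qed

end

section \<open>Brownian bridges on the two halves of the time interval\<close>

lemma nn_integral_lborel_swap:
  fixes A :: "'a :: euclidean_space \<Rightarrow> 'b :: euclidean_space \<Rightarrow> ennreal"
  assumes "case_prod A \<in> borel_measurable (borel \<Otimes>\<^sub>M borel)"
  shows "(\<integral>\<^sup>+a. (\<integral>\<^sup>+b. A a b \<partial>lborel) \<partial>lborel) = (\<integral>\<^sup>+b. (\<integral>\<^sup>+a. A a b \<partial>lborel) \<partial>lborel)"
  using assms by (intro lborel_pair.Fubini'[symmetric]) (simp add: lborel_prod[symmetric] borel_prod cong: measurable_cong_sets)

lemma nn_integral_lborel_rotate:
  fixes A :: "'a :: euclidean_space \<Rightarrow> 'b :: euclidean_space \<Rightarrow> 'c :: euclidean_space \<Rightarrow> ennreal"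
  assumes A: "(\<lambda>(a, b, c). A a b c) \<in> borel_measurable (borel \<Otimes>\<^sub>M borel \<Otimes>\<^sub>M borel)"
  shows "(\<integral>\<^sup>+a. (\<integral>\<^sup>+b. (\<integral>\<^sup>+c. A a b c \<partial>lborel) \<partial>lborel) \<partial>lborel)
    = (\<integral>\<^sup>+b. (\<integral>\<^sup>+c. (\<integral>\<^sup>+a. A a b c \<partial>lborel) \<partial>lborel) \<partial>lborel)"
proof -
  define B where "B = (\<lambda>(a, b, c). A a b c)"
  have [measurable]: "B \<in> borel_measurable (borel \<Otimes>\<^sub>M borel \<Otimes>\<^sub>M borel)"
    using A by (simp add: B_def)
  have A_eq: "A a b c = B (a, b, c)" for a b c by (simp add: B_def)
  have "(\<integral>\<^sup>+a. (\<integral>\<^sup>+b. (\<integral>\<^sup>+c. B (a, b, c) \<partial>lborel) \<partial>lborel) \<partial>lborel)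
      = (\<integral>\<^sup>+b. (\<integral>\<^sup>+a. (\<integral>\<^sup>+c. B (a, b, c) \<partial>lborel) \<partial>lborel) \<partial>lborel)"
    by (rule nn_integral_lborel_swap) measurable
  also have "\<dots> = (\<integral>\<^sup>+b. (\<integral>\<^sup>+c. (\<integral>\<^sup>+a. B (a, b, c) \<partial>lborel) \<partial>lborel) \<partial>lborel)"
    by (intro nn_integral_cong nn_integral_lborel_swap) measurable
  finally show ?thesis by (simp only: A_eq)
qed

text \<open>The Brownian bridge: given the values \<open>x\<close> and \<open>z\<close> at the ends of an interval of length \<open>v + w\<close>,
  the value \<open>a\<close> at time \<open>v\<close> is Gaussian with variance \<open>v w / (v + w)\<close>.\<close>

lemma gauss_bridge:
  fixes x a z :: "real ^ 'n"
  assumes "v > 0" "w > 0"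
  shows "gauss v (a - x) * gauss w (z - a) =
    gauss (v + w) (z - x) * gauss (v * w / (v + w)) (a - (x + (v / (v + w)) *\<^sub>R (z - x)))"
proof -
  \<comment> \<open>Coordinates are centred at \<open>x\<close>, and \<open>gauss_mult_gauss\<close>
    is used with \<open>c = 1\<close>.\<close>
  have "gauss v (a - x) * gauss w ((z - x) - 1 *\<^sub>R (a - x)) = gauss (w + 1\<^sup>2 * v) (z - x) *
      gauss (v * w / (w + 1\<^sup>2 * v)) ((a - x) - (1 * v / (w + 1\<^sup>2 * v)) *\<^sub>R (z - x))"
    by (rule gauss_mult_gauss[OF assms])
  moreover have "(z - x) - 1 *\<^sub>R (a - x) = z - a" by simp
  moreover have "w + 1\<^sup>2 * v = v + w" by simp
  moreover have "(a - x) - (1 * v / (v + w)) *\<^sub>R (z - x) = a - (x + (v / (v + w)) *\<^sub>R (z - x))"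
    by (simp add: algebra_simps)
  ultimately show ?thesis by metis
qed

lemma gauss_bridge_half:
  fixes x a z :: "real ^ 'n"
  assumes "v > 0" "w > 0" "v + w = 1 / 2"
  shows "ennreal (gauss v (a - x)) * ennreal (gauss w (z - a)) =
    ennreal (gauss (1 / 2) (z - x)) * ennreal (gauss (2 * v * w) (a - (x + (2 * v) *\<^sub>R (z - x))))"
  using gauss_bridge[OF assms(1,2), of a x z] assms
  by (simp add: ennreal_mult[symmetric] mult_ac)

text \<open>A Gaussian \<open>z\<close> of variance \<open>v\<close> feeds the mean
  \<open>m + c z\<close> of a Gaussian of variance \<open>w\<close>; after exchanging the integrals,
  \<open>nn_integral_gauss_convolution\<close> yields a Gaussian of mean \<open>m\<close>.\<close>

lemma nn_integral_gauss_smoothing: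
  fixes G :: "real ^ 'n \<Rightarrow> ennreal"
  assumes [measurable]: "G \<in> borel_measurable borel" and vw: "v > 0" "w > 0"
  shows "(\<integral>\<^sup>+z. ennreal (gauss v z) * (\<integral>\<^sup>+a. ennreal (gauss w (a - (m + c *\<^sub>R z))) * G a \<partial>lborel) \<partial>lborel)
    = (\<integral>\<^sup>+a. ennreal (gauss (w + c\<^sup>2 * v) (a - m)) * G a \<partial>lborel)"
proof -
  have "(\<integral>\<^sup>+z. ennreal (gauss v z) * (\<integral>\<^sup>+a. ennreal (gauss w (a - (m + c *\<^sub>R z))) * G a \<partial>lborel) \<partial>lborel)
      = (\<integral>\<^sup>+z. (\<integral>\<^sup>+a. G a * (ennreal (gauss v z) * ennreal (gauss w ((a - m) - c *\<^sub>R z))) \<partial>lborel) \<partial>lborel)"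
    by (subst nn_integral_cmult[symmetric]) (auto simp: mult_ac diff_diff_eq)
  also have "\<dots> = (\<integral>\<^sup>+a. (\<integral>\<^sup>+z. G a * (ennreal (gauss v z) * ennreal (gauss w ((a - m) - c *\<^sub>R z))) \<partial>lborel) \<partial>lborel)"
    by (rule nn_integral_lborel_swap) measurable
  also have "\<dots> = (\<integral>\<^sup>+a. G a * ennreal (gauss (w + c\<^sup>2 * v) (a - m)) \<partial>lborel)"
    using vw by (subst nn_integral_cmult) (auto simp: nn_integral_gauss_convolution)
  finally show ?thesis by (simp add: mult.commute)
qed

context brownian_motion
begin

lemma nn_integral_bridge_left:
  assumes t: "0 < t" "t < 1 / 2"
    and [measurable]: "F \<in> borel_measurable (borel \<Otimes>\<^sub>M borel \<Otimes>\<^sub>M borel)" "G \<in> borel_measurable borel"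
  shows "(\<integral>\<^sup>+\<omega>. F (\<omega> 0, \<omega> (1/2), \<omega> 1) * G (\<omega> t) \<partial>R) =
    (\<integral>\<^sup>+\<omega>. F (\<omega> 0, \<omega> (1/2), \<omega> 1) *
      (\<integral>\<^sup>+a. ennreal (gauss (2 * t * (1/2 - t)) (a - (\<omega> 0 + (2 * t) *\<^sub>R (\<omega> (1/2) - \<omega> 0)))) * G a \<partial>lborel) \<partial>R)"
proof -
  let ?g = "\<lambda>v x. ennreal (gauss v x)"
  have b: "?g t (a - x) * ?g (1/2 - t) (z - a) * ?g (1 - 1/2) (y - z) * (F (x, z, y) * G a)
      = ?g (1/2) (z - x) * ?g (1/2) (y - z) * F (x, z, y) *
        (?g (2 * t * (1/2 - t)) (a - (x + (2 * t) *\<^sub>R (z - x))) * G a)" for x a z y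
    using gauss_bridge_half[of t "1/2 - t" a x z] t by (simp add: mult_ac)
  have "(\<integral>\<^sup>+\<omega>. F (\<omega> 0, \<omega> (1/2), \<omega> 1) * G (\<omega> t) \<partial>R) =
      (\<integral>\<^sup>+\<omega>. (\<integral>\<^sup>+a. (\<integral>\<^sup>+z. (\<integral>\<^sup>+y. ?g t (a - \<omega> 0) * ?g (1/2 - t) (z - a) * ?g (1 - 1/2) (y - z) *
        (F (\<omega> 0, z, y) * G a) \<partial>lborel) \<partial>lborel) \<partial>lborel) \<partial>R)"
    using nn_integral_four_times[of t "1/2" "\<lambda>(x, a, z, y). F (x, z, y) * G a"] t by simp
  also have "\<dots> = (\<integral>\<^sup>+\<omega>. (\<integral>\<^sup>+z. (\<integral>\<^sup>+y. (\<integral>\<^sup>+a. ?g (1/2) (z - \<omega> 0) * ?g (1/2) (y - z) * F (\<omega> 0, z, y) *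
      (?g (2 * t * (1/2 - t)) (a - (\<omega> 0 + (2 * t) *\<^sub>R (z - \<omega> 0))) * G a) \<partial>lborel) \<partial>lborel) \<partial>lborel) \<partial>R)"
    unfolding b by (intro nn_integral_cong nn_integral_lborel_rotate) measurable
  also have "\<dots> = (\<integral>\<^sup>+\<omega>. (\<integral>\<^sup>+z. (\<integral>\<^sup>+y. ?g (1/2) (z - \<omega> 0) * ?g (1/2) (y - z) * (F (\<omega> 0, z, y) *
      (\<integral>\<^sup>+a. ?g (2 * t * (1/2 - t)) (a - (\<omega> 0 + (2 * t) *\<^sub>R (z - \<omega> 0))) * G a \<partial>lborel)) \<partial>lborel) \<partial>lborel) \<partial>R)"
    by (simp add: nn_integral_cmult mult.assoc)
  also have "\<dots> = (\<integral>\<^sup>+\<omega>. F (\<omega> 0, \<omega> (1/2), \<omega> 1) *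
      (\<integral>\<^sup>+a. ?g (2 * t * (1/2 - t)) (a - (\<omega> 0 + (2 * t) *\<^sub>R (\<omega> (1/2) - \<omega> 0))) * G a \<partial>lborel) \<partial>R)"
    using nn_integral_three_times[of "1/2" "\<lambda>(x, z, y). F (x, z, y) *
      (\<integral>\<^sup>+a. ?g (2 * t * (1/2 - t)) (a - (x + (2 * t) *\<^sub>R (z - x))) * G a \<partial>lborel)"] by simp
  finally show ?thesis .
qed

text \<open>Mirror image of the left half; \<open>a\<close> now sits between \<open>z\<close> and
  \<open>y\<close>, so a single exchange of integrals brings it inside.\<close>

lemma nn_integral_bridge_right:
  assumes t: "1 / 2 < t" "t < 1"
    and [measurable]: "F \<in> borel_measurable (borel \<Otimes>\<^sub>M borel \<Otimes>\<^sub>M borel)" "G \<in> borel_measurable borel"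
  shows "(\<integral>\<^sup>+\<omega>. F (\<omega> 0, \<omega> (1/2), \<omega> 1) * G (\<omega> t) \<partial>R) =
    (\<integral>\<^sup>+\<omega>. F (\<omega> 0, \<omega> (1/2), \<omega> 1) *
      (\<integral>\<^sup>+a. ennreal (gauss (2 * (t - 1/2) * (1 - t)) (a - (\<omega> (1/2) + (2 * (t - 1/2)) *\<^sub>R (\<omega> 1 - \<omega> (1/2))))) * G a
        \<partial>lborel) \<partial>R)"
proof -
  let ?g = "\<lambda>v x. ennreal (gauss v x)" and ?w = "2 * (t - 1/2) * (1 - t)" and ?c = "2 * (t - 1/2)"
  have b: "?g (1/2) (z - x) * ?g (t - 1/2) (a - z) * ?g (1 - t) (y - a) * (F (x, z, y) * G a)
      = ?g (1/2) (z - x) * ?g (1/2) (y - z) * F (x, z, y) *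
        (?g ?w (a - (z + ?c *\<^sub>R (y - z))) * G a)" for x a z y
    using gauss_bridge_half[of "t - 1/2" "1 - t" a z y] t by (simp add: mult.assoc) (simp add: mult_ac)
  have "(\<integral>\<^sup>+\<omega>. F (\<omega> 0, \<omega> (1/2), \<omega> 1) * G (\<omega> t) \<partial>R) =
      (\<integral>\<^sup>+\<omega>. (\<integral>\<^sup>+z. (\<integral>\<^sup>+a. (\<integral>\<^sup>+y. ?g (1/2) (z - \<omega> 0) * ?g (t - 1/2) (a - z) * ?g (1 - t) (y - a) *
        (F (\<omega> 0, z, y) * G a) \<partial>lborel) \<partial>lborel) \<partial>lborel) \<partial>R)"
    using nn_integral_four_times[of "1/2" t "\<lambda>(x, z, a, y). F (x, z, y) * G a"] t by simp
  also have "\<dots> = (\<integral>\<^sup>+\<omega>. (\<integral>\<^sup>+z. (\<integral>\<^sup>+y. (\<integral>\<^sup>+a. ?g (1/2) (z - \<omega> 0) * ?g (1/2) (y - z) * F (\<omega> 0, z, y) *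
      (?g ?w (a - (z + ?c *\<^sub>R (y - z))) * G a) \<partial>lborel) \<partial>lborel) \<partial>lborel) \<partial>R)"
    unfolding b by (intro nn_integral_cong nn_integral_lborel_swap) measurable
  also have "\<dots> = (\<integral>\<^sup>+\<omega>. (\<integral>\<^sup>+z. (\<integral>\<^sup>+y. ?g (1/2) (z - \<omega> 0) * ?g (1/2) (y - z) * (F (\<omega> 0, z, y) *
      (\<integral>\<^sup>+a. ?g ?w (a - (z + ?c *\<^sub>R (y - z))) * G a \<partial>lborel)) \<partial>lborel) \<partial>lborel) \<partial>R)"
    by (simp add: nn_integral_cmult mult.assoc)
  also have "\<dots> = (\<integral>\<^sup>+\<omega>. F (\<omega> 0, \<omega> (1/2), \<omega> 1) *
      (\<integral>\<^sup>+a. ?g ?w (a - (\<omega> (1/2) + ?c *\<^sub>R (\<omega> 1 - \<omega> (1/2)))) * G a \<partial>lborel) \<partial>R)"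
    using nn_integral_three_times[of "1/2" "\<lambda>(x, z, y). F (x, z, y) *
      (\<integral>\<^sup>+a. ?g ?w (a - (z + ?c *\<^sub>R (y - z))) * G a \<partial>lborel)"] by simp
  finally show ?thesis .
qed

end

subsection \<open>Bridges through an independent Gaussian midpoint\<close>

locale bridged_coupling = brownian_motion chi R for chi :: "(real ^ 'n) measure" and R +
  fixes \<pi> :: "((real ^ 'n) \<times> (real ^ 'n)) measure" and \<rho> :: "(real ^ 'n) \<times> (real ^ 'n) \<Rightarrow> real"
  assumes \<rho>_density: "prob_density_on (endpoint_law R) \<rho>" "\<pi> = density (endpoint_law R) \<rho>"
    and fst_\<pi>: "distr \<pi> borel fst = centred_gaussian (1 / 4)"
    and snd_\<pi>: "distr \<pi> borel snd = centred_gaussian (1 / 4)"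
    and \<rho>_entropy: "integrable (endpoint_law R) (\<lambda>z. \<rho> z * ln (\<rho> z))"
begin

text \<open>The midpoint of the Brownian bridge from \<open>x\<close> to \<open>y\<close> over unit
  time has mean \<open>(x + y) / 2\<close> and variance 1/4, the same as the target variance. The
  ratio exchanges its density for that of an independent N(0, 1/4) midpoint.\<close>

definition kernel_ratio :: "(real ^ 'n) \<times> (real ^ 'n) \<times> (real ^ 'n) \<Rightarrow> real" where
  "kernel_ratio = (\<lambda>(x, z, y). gauss (1 / 4) z / gauss (1 / 4) (z - (x + (1 / 2) *\<^sub>R (y - x))))"

text \<open>The factor \<open>\<rho>\<close> reweights the endpoints and the ratio reweights the
  midpoint; the bridges on the two halves stay Brownian, so only three times occur.\<close>

definition bridged_density :: "(real \<Rightarrow> real ^ 'n) \<Rightarrow> real" where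
  "bridged_density \<omega> = \<rho> (\<omega> 0, \<omega> 1) * kernel_ratio (\<omega> 0, \<omega> (1 / 2), \<omega> 1)"

definition bridged_law :: "(real \<Rightarrow> real ^ 'n) measure" where
  "bridged_law = density R (\<lambda>\<omega>. ennreal (bridged_density \<omega>))"

lemma sets_endpoint_law [simp, measurable_cong]: "sets (endpoint_law R) = sets borel"
  by (simp add: endpoint_law_def)

lemma sets_\<pi> [measurable_cong]: "sets \<pi> = sets borel"
  by (simp add: \<rho>_density)

lemma \<rho>_measurable [measurable]: "\<rho> \<in> borel_measurable (borel \<Otimes>\<^sub>M borel)"
  using prob_density_onD(1)[OF \<rho>_density(1)] unfolding borel_prod by (simp cong: measurable_cong_sets)

lemma \<rho>_nonneg: "0 \<le> \<rho> z"
  using prob_density_onD(2)[OF \<rho>_density(1)] .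

lemma kernel_ratio_measurable [measurable]:
  "kernel_ratio \<in> borel_measurable (borel \<Otimes>\<^sub>M borel \<Otimes>\<^sub>M borel)"
  unfolding kernel_ratio_def by measurable

lemma kernel_ratio_pos: "0 < kernel_ratio p"
  by (auto simp: kernel_ratio_def gauss_pos split: prod.split)

lemma bridged_density_measurable [measurable]: "bridged_density \<in> borel_measurable R"
  unfolding bridged_density_def[abs_def] by measurable

lemma bridged_density_nonneg: "0 \<le> bridged_density \<omega>"
  using \<rho>_nonneg kernel_ratio_pos by (simp add: bridged_density_def less_imp_le)

text \<open>Two half steps factor into the unit step times the bridge density of the midpoint, and
  that density cancels against the denominator of the ratio.\<close>

lemma gauss_kernel_ratio:
  "ennreal (gauss (1/2) (z - x)) * ennreal (gauss (1/2) (y - z)) * ennreal (kernel_ratio (x, z, y))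
    = ennreal (gauss 1 (y - x)) * ennreal (gauss (1/4) z)"
proof -
  have "gauss (1/2) (z - x) * gauss (1/2) (y - z) =
      gauss 1 (y - x) * gauss (1/4) (z - (x + (1/2) *\<^sub>R (y - x)))"
    using gauss_bridge[of "1/2" "1/2" z x y] by simp
  then have "gauss (1/2) (z - x) * gauss (1/2) (y - z) * kernel_ratio (x, z, y)
      = gauss 1 (y - x) * gauss (1/4) z"
    using gauss_pos[of "1/4" "z - (x + (1/2) *\<^sub>R (y - x))"] by (simp add: kernel_ratio_def)
  then show ?thesis
    using kernel_ratio_pos[of "(x, z, y)"] by (simp add: ennreal_mult[symmetric] less_imp_le)
qed

lemma nn_integral_bridged_law:
  assumes "F \<in> borel_measurable R"
  shows "(\<integral>\<^sup>+\<omega>. F \<omega> \<partial>bridged_law) = (\<integral>\<^sup>+\<omega>. ennreal (bridged_density \<omega>) * F \<omega> \<partial>R)"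
  unfolding bridged_law_def by (rule nn_integral_density[OF _ assms]) measurable

text \<open>By \<open>gauss_kernel_ratio\<close> the three-time kernel of \<open>R\<close> becomes
  the endpoint kernel times the density of the midpoint. Read backwards,
  \<open>nn_integral_two_times\<close> restores an integral over endpoints, where
  \<open>\<rho>\<close> turns \<open>endpoint_law R\<close> into \<open>\<pi>\<close>. So the
  midpoint is independent of the endpoints.\<close>

lemma three_point_law:
  assumes [measurable]: "F \<in> borel_measurable (borel \<Otimes>\<^sub>M borel \<Otimes>\<^sub>M borel)"
  shows "(\<integral>\<^sup>+\<omega>. F (\<omega> 0, \<omega> (1/2), \<omega> 1) \<partial>bridged_law) =
    (\<integral>\<^sup>+p. (\<integral>\<^sup>+z. ennreal (gauss (1/4) z) * F (fst p, z, snd p) \<partial>lborel) \<partial>\<pi>)"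
proof -
  let ?g = "\<lambda>v x. ennreal (gauss v x)"
  define W where "W p = (\<integral>\<^sup>+z. ?g (1/4) z * F (fst p, z, snd p) \<partial>lborel)" for p
  have [measurable]: "W \<in> borel_measurable (borel \<Otimes>\<^sub>M borel)"
    unfolding W_def[abs_def] by measurable
  have W': "W \<in> borel_measurable borel" using \<open>W \<in> _\<close> by (subst (asm) borel_prod)
  have id: "?g (1/2) (z - x) * ?g (1/2) (y - z) * (ennreal (\<rho> (x, y)) * ennreal (kernel_ratio (x, z, y)) * F (x, z, y))
      = ?g 1 (y - x) * (ennreal (\<rho> (x, y)) * (?g (1/4) z * F (x, z, y)))" for x y z
  proof -
    have "?g (1/2) (z - x) * ?g (1/2) (y - z) * (ennreal (\<rho> (x, y)) * ennreal (kernel_ratio (x, z, y)) * F (x, z, y))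
      = (?g (1/2) (z - x) * ?g (1/2) (y - z) * ennreal (kernel_ratio (x, z, y))) * ennreal (\<rho> (x, y)) * F (x, z, y)"
      by (simp only: mult_ac)
    then show ?thesis unfolding gauss_kernel_ratio by (simp only: mult_ac)
  qed
  have "(\<integral>\<^sup>+\<omega>. F (\<omega> 0, \<omega> (1/2), \<omega> 1) \<partial>bridged_law) =
      (\<integral>\<^sup>+\<omega>. ennreal (\<rho> (\<omega> 0, \<omega> 1)) * ennreal (kernel_ratio (\<omega> 0, \<omega> (1/2), \<omega> 1)) * F (\<omega> 0, \<omega> (1/2), \<omega> 1) \<partial>R)"
    using \<rho>_nonneg kernel_ratio_pos
    by (subst nn_integral_bridged_law) (auto simp: bridged_density_def ennreal_mult less_imp_le)
  also have "\<dots> = (\<integral>\<^sup>+\<omega>. (\<integral>\<^sup>+z. (\<integral>\<^sup>+y. ?g (1/2) (z - \<omega> 0) * ?g (1/2) (y - z) *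
      (ennreal (\<rho> (\<omega> 0, y)) * ennreal (kernel_ratio (\<omega> 0, z, y)) * F (\<omega> 0, z, y)) \<partial>lborel) \<partial>lborel) \<partial>R)"
    using nn_integral_three_times[of "1/2" "\<lambda>(x, z, y). ennreal (\<rho> (x, y)) * ennreal (kernel_ratio (x, z, y)) * F (x, z, y)"]
    by simp
  also have "\<dots> = (\<integral>\<^sup>+\<omega>. (\<integral>\<^sup>+y. (\<integral>\<^sup>+z. ?g 1 (y - \<omega> 0) * (ennreal (\<rho> (\<omega> 0, y)) *
      (?g (1/4) z * F (\<omega> 0, z, y))) \<partial>lborel) \<partial>lborel) \<partial>R)"
    unfolding id by (intro nn_integral_cong nn_integral_lborel_swap) measurable
  also have "\<dots> = (\<integral>\<^sup>+\<omega>. (\<integral>\<^sup>+y. ?g 1 (y - \<omega> 0) * (ennreal (\<rho> (\<omega> 0, y)) * W (\<omega> 0, y)) \<partial>lborel) \<partial>R)"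
    by (simp add: nn_integral_cmult W_def)
  also have "\<dots> = (\<integral>\<^sup>+\<omega>. ennreal (\<rho> (\<omega> 0, \<omega> 1)) * W (\<omega> 0, \<omega> 1) \<partial>R)"
    using nn_integral_two_times[of "\<lambda>p. ennreal (\<rho> p) * W p"] by simp
  also have "\<dots> = (\<integral>\<^sup>+p. ennreal (\<rho> p) * W p \<partial>endpoint_law R)"
    unfolding endpoint_law_def borel_prod[symmetric]
    by (subst nn_integral_distr) auto
  also have "\<dots> = (\<integral>\<^sup>+p. W p \<partial>\<pi>)"
    unfolding \<rho>_density(2) using W' prob_density_onD(1)[OF \<rho>_density(1)]
    by (intro nn_integral_density[symmetric]) (auto cong: measurable_cong_sets)
  finally show ?thesis by (simp add: W_def)
qed

lemma \<pi>_prob_space: "prob_space \<pi>"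
  using \<rho>_density prob_density_on_iff[of \<rho> "endpoint_law R"] prob_density_onD[OF \<rho>_density(1)]
  by blast

lemma nn_integral_fst_\<pi>:
  assumes [measurable]: "G \<in> borel_measurable borel"
  shows "(\<integral>\<^sup>+p. G (fst p) \<partial>\<pi>) = (\<integral>\<^sup>+x. ennreal (gauss (1/4) x) * G x \<partial>lborel)"
proof -
  have m: "fst \<in> borel_measurable \<pi>"
    unfolding measurable_cong_sets[OF sets_\<pi> refl] borel_prod[symmetric] by (rule measurable_fst)
  have "(\<integral>\<^sup>+p. G (fst p) \<partial>\<pi>) = (\<integral>\<^sup>+x. G x \<partial>distr \<pi> borel fst)"
    by (rule nn_integral_distr[OF m, symmetric]) simp
  also have "\<dots> = (\<integral>\<^sup>+x. ennreal (gauss (1/4) x) * G x \<partial>lborel)"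
    unfolding fst_\<pi> by (subst centred_gaussian_eq) (auto simp: nn_integral_density)
  finally show ?thesis .
qed

lemma nn_integral_snd_\<pi>:
  assumes [measurable]: "G \<in> borel_measurable borel"
  shows "(\<integral>\<^sup>+p. G (snd p) \<partial>\<pi>) = (\<integral>\<^sup>+x. ennreal (gauss (1/4) x) * G x \<partial>lborel)"
proof -
  have m: "snd \<in> borel_measurable \<pi>"
    unfolding measurable_cong_sets[OF sets_\<pi> refl] borel_prod[symmetric] by (rule measurable_snd)
  have "(\<integral>\<^sup>+p. G (snd p) \<partial>\<pi>) = (\<integral>\<^sup>+x. G x \<partial>distr \<pi> borel snd)"
    by (rule nn_integral_distr[OF m, symmetric]) simp
  also have "\<dots> = (\<integral>\<^sup>+x. ennreal (gauss (1/4) x) * G x \<partial>lborel)"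
    unfolding snd_\<pi> by (subst centred_gaussian_eq) (auto simp: nn_integral_density)
  finally show ?thesis .
qed

section \<open>Time marginals of the bridged law\<close>

lemma nn_integral_endpoints_bridged:
  assumes [measurable]: "G \<in> borel_measurable (borel \<Otimes>\<^sub>M borel)"
  shows "(\<integral>\<^sup>+\<omega>. G (\<omega> 0, \<omega> 1) \<partial>bridged_law) = (\<integral>\<^sup>+p. G p \<partial>\<pi>)"
  using three_point_law[of "\<lambda>(x, z, y). G (x, y)"]
  by (simp add: nn_integral_multc nn_integral_gauss)

lemma nn_integral_half_bridged:
  assumes [measurable]: "G \<in> borel_measurable borel"
  shows "(\<integral>\<^sup>+\<omega>. G (\<omega> (1/2)) \<partial>bridged_law) = (\<integral>\<^sup>+x. ennreal (gauss (1/4) x) * G x \<partial>lborel)"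
proof -
  interpret \<pi>: prob_space \<pi> by (rule \<pi>_prob_space)
  show ?thesis
    using three_point_law[of "\<lambda>(x, z, y). G z"] by (simp add: \<pi>.emeasure_space_1)
qed

text \<open>Smoothing is applied twice: the average over \<open>z\<close> adds
  \<open>\<beta>^2 / 4\<close> to the variance \<open>v\<close>, and the average over
  \<open>x\<close> adds \<open>\<alpha>^2 / 4\<close>.\<close>

lemma gaussian_mixture:
  assumes [measurable]: "G \<in> borel_measurable borel"
    and v: "v > 0" "v + \<alpha>\<^sup>2 / 4 + \<beta>\<^sup>2 / 4 = 1 / 4"
  shows "(\<integral>\<^sup>+x. ennreal (gauss (1/4) x) * (\<integral>\<^sup>+z. ennreal (gauss (1/4) z) *
      (\<integral>\<^sup>+a. ennreal (gauss v (a - (\<alpha> *\<^sub>R x + \<beta> *\<^sub>R z))) * G a \<partial>lborel) \<partial>lborel) \<partial>lborel)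
    = (\<integral>\<^sup>+a. ennreal (gauss (1/4) (a :: real ^ 'n)) * G a \<partial>lborel)"
proof -
  have w: "v + \<beta>\<^sup>2 * (1/4) > 0" using v(1) by (simp add: add_pos_nonneg)
  have e: "v + \<beta>\<^sup>2 * (1/4) + \<alpha>\<^sup>2 * (1/4) = 1/4" using v(2) by simp
  show ?thesis
    using nn_integral_gauss_smoothing[of G "1/4" "v + \<beta>\<^sup>2 * (1/4)" 0 \<alpha>, unfolded e] w v(1)
    by (simp add: nn_integral_gauss_smoothing)
qed

text \<open>The density depends only on times 0, 1/2 and 1, so given these values the bridge
  formulas of \<open>R\<close> stay valid. Between these times the position is a combination of one
  endpoint, the independent midpoint and bridge noise, whose variance contributions add up to
  1/4.\<close>

lemma nn_integral_marginal_bridged: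
  assumes t: "t \<in> {0..1}" and G[measurable]: "G \<in> borel_measurable borel"
  shows "(\<integral>\<^sup>+\<omega>. G (\<omega> t) \<partial>bridged_law) = (\<integral>\<^sup>+x. ennreal (gauss (1/4) x) * G x \<partial>lborel)"
proof -
  let ?g = "\<lambda>v x. ennreal (gauss v x)"
  let ?f = "\<lambda>(x, z, y). ennreal (\<rho> (x, y) * kernel_ratio (x, z, y))"
  have bd: "ennreal (bridged_density \<omega>) = ?f (\<omega> 0, \<omega> (1/2), \<omega> 1)" for \<omega>
    by (simp add: bridged_density_def)
  \<comment> \<open>At 0, 1/2 and 1 the bridge variance degenerates to 0, so these times are read
    off from the endpoint and midpoint laws.\<close>
  consider "t = 0" | "0 < t" "t < 1/2" | "t = 1/2" | "1/2 < t" "t < 1" | "t = 1"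
    using t by fastforce
  then show ?thesis
  proof cases
    case 1
    then show ?thesis
      using nn_integral_endpoints_bridged[of "\<lambda>p. G (fst p)"] by (simp add: nn_integral_fst_\<pi>)
  next
    case 2
    define w where "w = 2 * t * (1/2 - t)"
    have w: "w > 0" using 2 by (simp add: w_def)
    define V where "V = (\<lambda>(x, z). \<integral>\<^sup>+a. ?g w (a - ((1 - 2 * t) *\<^sub>R x + (2 * t) *\<^sub>R z)) * G a \<partial>lborel)"
    have V: "(\<integral>\<^sup>+a. ?g (2 * t * (1/2 - t)) (a - (x + (2 * t) *\<^sub>R (z - x))) * G a \<partial>lborel) = V (x, z)" for x z
    proof -
      have "x + (2 * t) *\<^sub>R (z - x) = (1 - 2 * t) *\<^sub>R x + (2 * t) *\<^sub>R z"
        by (simp add: algebra_simps)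
      then show ?thesis by (simp only: V_def w_def split_conv)
    qed
    have [measurable]: "V \<in> borel_measurable (borel \<Otimes>\<^sub>M borel)"
      unfolding V_def by measurable
    have "(\<integral>\<^sup>+\<omega>. G (\<omega> t) \<partial>bridged_law) = (\<integral>\<^sup>+\<omega>. ?f (\<omega> 0, \<omega> (1/2), \<omega> 1) * G (\<omega> t) \<partial>R)"
      using t by (subst nn_integral_bridged_law) (auto simp: bd)
    also have "\<dots> = (\<integral>\<^sup>+\<omega>. ?f (\<omega> 0, \<omega> (1/2), \<omega> 1) * V (\<omega> 0, \<omega> (1/2)) \<partial>R)"
      using 2 unfolding V[symmetric] by (intro nn_integral_bridge_left) auto
    also have "\<dots> = (\<integral>\<^sup>+\<omega>. V (\<omega> 0, \<omega> (1/2)) \<partial>bridged_law)"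
      by (subst nn_integral_bridged_law) (auto simp: bd)
    also have "\<dots> = (\<integral>\<^sup>+p. (\<integral>\<^sup>+z. ?g (1/4) z * V (fst p, z) \<partial>lborel) \<partial>\<pi>)"
      using three_point_law[of "\<lambda>(x, z, y). V (x, z)"] by simp
    \<comment> \<open>Only the start and the midpoint enter \<open>V\<close>; as the midpoint is
      independent, the first marginal of \<open>\<pi>\<close> determines the value, whatever the
      coupling.\<close>
    also have "\<dots> = (\<integral>\<^sup>+x. ?g (1/4) x * (\<integral>\<^sup>+z. ?g (1/4) z * V (x, z) \<partial>lborel) \<partial>lborel)"
      by (rule nn_integral_fst_\<pi>) measurable
    also have "\<dots> = (\<integral>\<^sup>+x. ?g (1/4) x * G x \<partial>lborel)"
    proof -
      have "w + (1 - 2 * t)\<^sup>2 / 4 + (2 * t)\<^sup>2 / 4 = 1 / 4"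
        by (simp add: w_def power2_eq_square field_simps)
      from gaussian_mixture[OF G w this] show ?thesis by (simp add: V_def)
    qed
    finally show ?thesis .
  next
    case 3
    show ?thesis unfolding 3 by (rule nn_integral_half_bridged) measurable
  next
    case 4
    define w where "w = 2 * (t - 1/2) * (1 - t)"
    have w: "w > 0" using 4 by (simp add: w_def)
    \<comment> \<open>Mirror image of the first half: the terminal point \<open>y\<close> takes the
      role of \<open>x\<close>, and the weight \<open>2 - 2 t\<close> of the midpoint decreases to 0
      at time 1.\<close>
    define V where "V = (\<lambda>(y, z). \<integral>\<^sup>+a. ?g w (a - ((2 * t - 1) *\<^sub>R y + (2 - 2 * t) *\<^sub>R z)) * G a \<partial>lborel)"
    have V: "(\<integral>\<^sup>+a. ?g (2 * (t - 1/2) * (1 - t)) (a - (z + (2 * (t - 1/2)) *\<^sub>R (y - z))) * G a \<partial>lborel) = V (y, z)" for y z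
    proof -
      have "z + (2 * (t - 1/2)) *\<^sub>R (y - z) = (2 * t - 1) *\<^sub>R y + (2 - 2 * t) *\<^sub>R z"
        by (simp add: vec_eq_iff algebra_simps)
      then show ?thesis by (simp only: V_def w_def split_conv)
    qed
    have [measurable]: "V \<in> borel_measurable (borel \<Otimes>\<^sub>M borel)"
      unfolding V_def by measurable
    have "(\<integral>\<^sup>+\<omega>. G (\<omega> t) \<partial>bridged_law) = (\<integral>\<^sup>+\<omega>. ?f (\<omega> 0, \<omega> (1/2), \<omega> 1) * G (\<omega> t) \<partial>R)"
      using t by (subst nn_integral_bridged_law) (auto simp: bd)
    also have "\<dots> = (\<integral>\<^sup>+\<omega>. ?f (\<omega> 0, \<omega> (1/2), \<omega> 1) * V (\<omega> 1, \<omega> (1/2)) \<partial>R)"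
      using 4 unfolding V[symmetric] by (intro nn_integral_bridge_right) auto
    also have "\<dots> = (\<integral>\<^sup>+\<omega>. V (\<omega> 1, \<omega> (1/2)) \<partial>bridged_law)"
      by (subst nn_integral_bridged_law) (auto simp: bd)
    also have "\<dots> = (\<integral>\<^sup>+p. (\<integral>\<^sup>+z. ?g (1/4) z * V (snd p, z) \<partial>lborel) \<partial>\<pi>)"
      using three_point_law[of "\<lambda>(x, z, y). V (y, z)"] by simp
    also have "\<dots> = (\<integral>\<^sup>+y. ?g (1/4) y * (\<integral>\<^sup>+z. ?g (1/4) z * V (y, z) \<partial>lborel) \<partial>lborel)"
      by (rule nn_integral_snd_\<pi>) measurable
    also have "\<dots> = (\<integral>\<^sup>+x. ?g (1/4) x * G x \<partial>lborel)"
    proof -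
      have "w + (2 * t - 1)\<^sup>2 / 4 + (2 - 2 * t)\<^sup>2 / 4 = 1 / 4"
        by (simp add: w_def power2_eq_square field_simps)
      from gaussian_mixture[OF G w this] show ?thesis by (simp add: V_def)
    qed
    finally show ?thesis .
  next
    case 5
    then show ?thesis
      using nn_integral_endpoints_bridged[of "\<lambda>p. G (snd p)"] by (simp add: nn_integral_snd_\<pi>)
  qed
qed

lemma sets_bridged_law [measurable_cong, simp]: "sets bridged_law = sets R"
  by (simp add: bridged_law_def)

lemma prob_space_bridged_law: "prob_space bridged_law"
  using nn_integral_half_bridged[of "\<lambda>_. 1"] by (intro prob_spaceI) (simp add: nn_integral_gauss)

lemma bridged_law_admissible: "BS_admissible (\<lambda>t. centred_gaussian (1 / 4)) \<pi> bridged_law"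
  unfolding BS_admissible_def path_law_def
proof (intro conjI ballI prob_space_bridged_law)
  show "sets bridged_law = sets path_space" by (simp add: sets_R)
  fix t :: real assume t: "t \<in> {0..1}"
  show "marginal bridged_law t = centred_gaussian (1 / 4)"
  proof (rule measure_eqI)
    show "sets (marginal bridged_law t) = sets (centred_gaussian (1 / 4))"
      by (simp add: marginal_def centred_gaussian_def)
    fix A assume "A \<in> sets (marginal bridged_law t)"
    then have [measurable]: "A \<in> sets borel" by (simp add: marginal_def)
    have "emeasure (marginal bridged_law t) A = (\<integral>\<^sup>+x. indicator A x \<partial>marginal bridged_law t)"
      by (simp add: marginal_def)
    also have "\<dots> = (\<integral>\<^sup>+\<omega>. indicator A (\<omega> t) \<partial>bridged_law)"
      unfolding marginal_def using t by (subst nn_integral_distr) auto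
    also have "\<dots> = (\<integral>\<^sup>+x. ennreal (gauss (1/4) x) * indicator A x \<partial>lborel)"
      by (rule nn_integral_marginal_bridged[OF t]) measurable
    also have "\<dots> = emeasure (centred_gaussian (1 / 4)) A"
      by (simp add: centred_gaussian_eq emeasure_density)
    finally show "emeasure (marginal bridged_law t) A = emeasure (centred_gaussian (1 / 4)) A" .
  qed
next
  show "endpoint_law bridged_law = \<pi>"
  proof (rule measure_eqI)
    show "sets (endpoint_law bridged_law) = sets \<pi>"
      by (simp add: endpoint_law_def sets_\<pi>)
    fix A assume "A \<in> sets (endpoint_law bridged_law)"
    then have A: "A \<in> sets borel" by (simp add: endpoint_law_def)
    then have [measurable]: "A \<in> sets (borel \<Otimes>\<^sub>M borel)" by (subst borel_prod)
    have "emeasure (endpoint_law bridged_law) A = (\<integral>\<^sup>+x. indicator A x \<partial>endpoint_law bridged_law)"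
      using A by (simp add: endpoint_law_def)
    also have "\<dots> = (\<integral>\<^sup>+\<omega>. indicator A (\<omega> 0, \<omega> 1) \<partial>bridged_law)"
      unfolding endpoint_law_def borel_prod[symmetric] by (subst nn_integral_distr) auto
    also have "\<dots> = (\<integral>\<^sup>+p. indicator A p \<partial>\<pi>)"
      by (rule nn_integral_endpoints_bridged) measurable
    also have "\<dots> = emeasure \<pi> A" using A by (simp add: sets_\<pi>)
    finally show "emeasure (endpoint_law bridged_law) A = emeasure \<pi> A" .
  qed
qed

section \<open>Finite entropy of the bridged law\<close>

lemma square_integrable_bridged:
  assumes t: "t \<in> {0..1}"
  shows "integrable bridged_law (\<lambda>\<omega>. (norm (\<omega> t))\<^sup>2)"
proof (rule integrableI_bounded)
  show "(\<lambda>\<omega>. (norm (\<omega> t))\<^sup>2) \<in> borel_measurable bridged_law" using t by measurable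
  have "(\<integral>\<^sup>+\<omega>. ennreal (norm ((norm (\<omega> t))\<^sup>2)) \<partial>bridged_law)
      = (\<integral>\<^sup>+x. ennreal (gauss (1/4) x) * ennreal ((norm (x :: real ^ 'n))\<^sup>2) \<partial>lborel)"
    using nn_integral_marginal_bridged[OF t, of "\<lambda>x. ennreal ((norm x)\<^sup>2)"] by simp
  also have "\<dots> = (\<integral>\<^sup>+x. ennreal ((norm x)\<^sup>2) \<partial>(centred_gaussian (1/4) :: (real ^ 'n) measure))"
    by (subst centred_gaussian_eq) (auto simp: nn_integral_density)
  also have "\<dots> < \<infinity>" by (rule gauss_second_moment_finite) simp
  finally show "(\<integral>\<^sup>+\<omega>. ennreal (norm ((norm (\<omega> t))\<^sup>2)) \<partial>bridged_law) < \<infinity>" .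
qed

text \<open>The two Gaussians have equal variance, so the normalising constants cancel; the factor 2
  is \<open>1 / (2 * (1 / 4))\<close>.\<close>

lemma ln_kernel_ratio:
  "ln (kernel_ratio (x, z, y)) = 2 * (norm (z - (x + (1/2) *\<^sub>R (y - x))))\<^sup>2 - 2 * (norm z)\<^sup>2"
proof -
  have "kernel_ratio (x, z, y) = exp (2 * (norm (z - (x + (1/2) *\<^sub>R (y - x))))\<^sup>2 - 2 * (norm z)\<^sup>2)"
    by (simp add: kernel_ratio_def gauss_def exp_diff exp_minus field_simps)
  then show ?thesis by simp
qed

text \<open>Quadratic growth is enough for integrability, since
  \<open>square_integrable_bridged\<close> supplies second moments; the constant 8 is
  generous.\<close>

lemma abs_ln_kernel_ratio_le:
  "\<bar>ln (kernel_ratio (x, z, y))\<bar> \<le> 8 * ((norm x)\<^sup>2 + (norm z)\<^sup>2 + (norm y)\<^sup>2)"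
proof -
  have "norm (z - (x + (1/2) *\<^sub>R (y - x))) = norm (z - (1/2) *\<^sub>R x - (1/2) *\<^sub>R y)"
    by (rule arg_cong[where f = norm]) (simp add: vec_eq_iff field_simps)
  also have "\<dots> \<le> norm z + norm ((1/2) *\<^sub>R x) + norm ((1/2) *\<^sub>R y)"
    by (rule order_trans[OF norm_triangle_ineq4 add_right_mono[OF norm_triangle_ineq4]])
  also have "\<dots> \<le> norm z + norm x + norm y" by (intro add_mono) auto
  finally have "(norm (z - (x + (1/2) *\<^sub>R (y - x))))\<^sup>2 \<le> (norm z + norm x + norm y)\<^sup>2"
    by (rule power_mono) simp
  also have "\<dots> \<le> 3 * ((norm z)\<^sup>2 + (norm x)\<^sup>2 + (norm y)\<^sup>2)"
  proof -
    have "(p + q + r)\<^sup>2 \<le> 3 * (p\<^sup>2 + q\<^sup>2 + r\<^sup>2)" for p q r :: real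
      using zero_le_power2[of "p - q"] zero_le_power2[of "p - r"] zero_le_power2[of "q - r"]
      by (simp add: power2_eq_square algebra_simps)
    then show ?thesis .
  qed
  finally have le: "(norm (z - (x + (1/2) *\<^sub>R (y - x))))\<^sup>2 \<le> 3 * ((norm z)\<^sup>2 + (norm x)\<^sup>2 + (norm y)\<^sup>2)" .
  have "0 \<le> A \<Longrightarrow> A \<le> 3 * (p + q + r) \<Longrightarrow> 0 \<le> p \<Longrightarrow> 0 \<le> q \<Longrightarrow> 0 \<le> r \<Longrightarrow>
      \<bar>2 * A - 2 * p\<bar> \<le> 8 * (q + p + r)" for A p q r :: real
    by argo
  then show ?thesis unfolding ln_kernel_ratio using le by simp
qed

lemma bridged_prob_density: "prob_density_on R bridged_density"
  using prob_space_bridged_law bridged_density_nonneg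
  by (subst prob_density_on_iff[OF bridged_density_measurable])
     (simp_all flip: bridged_law_def)

text \<open>The logarithm of the density is a sum. Its first term depends on the endpoints, whose
  law is \<open>\<pi>\<close>, and is integrable by \<open>\<rho>_entropy\<close>; the second is
  dominated by squared norms at three times, where the positions are Gaussian.\<close>

lemma bridged_law_finite_entropy: "rel_entropy bridged_law R < \<infinity>"
proof -
  have end\<pi>: "distr bridged_law borel (\<lambda>\<omega>. (\<omega> 0, \<omega> 1)) = \<pi>"
    using bridged_law_admissible by (simp add: BS_admissible_def endpoint_law_def)
  have \<rho>': "\<rho> \<in> borel_measurable borel" using \<rho>_measurable by (subst (asm) borel_prod)
  have T: "(\<lambda>\<omega>. (\<omega> 0, \<omega> 1)) \<in> borel_measurable bridged_law"
    unfolding borel_prod[symmetric]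
    by (intro measurable_Pair measurable_path_eval) (auto simp: sets_R)
  have "integrable \<pi> (\<lambda>p. ln (\<rho> p))"
    unfolding \<rho>_density(2) using \<rho>_entropy \<rho>_nonneg prob_density_onD(1)[OF \<rho>_density(1)]
    by (subst integrable_density) auto
  then have 1: "integrable bridged_law (\<lambda>\<omega>. ln (\<rho> (\<omega> 0, \<omega> 1)))"
    unfolding end\<pi>[symmetric] using T \<rho>' by (subst (asm) integrable_distr_eq) auto
  have 2: "integrable bridged_law (\<lambda>\<omega>. ln (kernel_ratio (\<omega> 0, \<omega> (1/2), \<omega> 1)))"
  proof (rule Bochner_Integration.integrable_bound)
    show "integrable bridged_law (\<lambda>\<omega>. 8 * ((norm (\<omega> 0))\<^sup>2 + (norm (\<omega> (1/2)))\<^sup>2 + (norm (\<omega> 1))\<^sup>2))"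
      by (intro integrable_mult_right Bochner_Integration.integrable_add square_integrable_bridged) auto
    show "AE \<omega> in bridged_law. norm (ln (kernel_ratio (\<omega> 0, \<omega> (1/2), \<omega> 1)))
        \<le> norm (8 * ((norm (\<omega> 0))\<^sup>2 + (norm (\<omega> (1/2)))\<^sup>2 + (norm (\<omega> 1))\<^sup>2))"
      using abs_ln_kernel_ratio_le by (intro AE_I2) simp
  qed measurable
  have "integrable bridged_law (\<lambda>\<omega>. ln (\<rho> (\<omega> 0, \<omega> 1)) + ln (kernel_ratio (\<omega> 0, \<omega> (1/2), \<omega> 1)))"
    using 1 2 by (rule Bochner_Integration.integrable_add)
  then have "integrable R (\<lambda>\<omega>. bridged_density \<omega> *
      (ln (\<rho> (\<omega> 0, \<omega> 1)) + ln (kernel_ratio (\<omega> 0, \<omega> (1/2), \<omega> 1))))"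
    unfolding bridged_law_def using bridged_density_nonneg
    by (subst (asm) integrable_density) auto
  \<comment> \<open>Where \<open>\<rho>\<close> vanishes both sides are 0; elsewhere both factors
    are positive and the logarithm splits.\<close>
  moreover have "bridged_density \<omega> * (ln (\<rho> (\<omega> 0, \<omega> 1)) + ln (kernel_ratio (\<omega> 0, \<omega> (1/2), \<omega> 1)))
      = bridged_density \<omega> * ln (bridged_density \<omega>)" for \<omega>
    using \<rho>_nonneg[of "(\<omega> 0, \<omega> 1)"] kernel_ratio_pos[of "(\<omega> 0, \<omega> (1/2), \<omega> 1)"]
    by (cases "\<rho> (\<omega> 0, \<omega> 1) = 0") (auto simp: bridged_density_def ln_mult)
  ultimately have "integrable R (\<lambda>\<omega>. bridged_density \<omega> * ln (bridged_density \<omega>))" by simp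
  then show ?thesis
    unfolding bridged_law_def rel_entropy_density[OF bridged_prob_density] by simp
qed

end

section \<open>Constraints as prescribed probabilities, and the equivalence\<close>

lemma distr_eq_iff_measure:
  assumes "prob_space P" "prob_space \<nu>" "sets \<nu> = sets N" and T[measurable]: "T \<in> measurable P N"
  shows "distr P N T = \<nu> \<longleftrightarrow> (\<forall>A\<in>sets N. measure P (T -` A \<inter> space P) = measure \<nu> A)"
proof
  assume eq: "\<forall>A\<in>sets N. measure P (T -` A \<inter> space P) = measure \<nu> A"
  interpret P: prob_space P by fact
  interpret \<nu>: prob_space \<nu> by fact
  show "distr P N T = \<nu>"
    using eq assms(3)
    by (intro measure_eqI) (auto simp: emeasure_distr P.emeasure_eq_measure \<nu>.emeasure_eq_measure)
qed (auto simp: measure_distr)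

text \<open>Admissibility at times 0 and 1 forces both marginals of \<open>\<pi>\<close> to be N(0,
  1/4). They are therefore assumed: with other marginals no law is admissible, even when the entropy
  of \<open>\<pi>\<close> is finite.\<close>

theorem theorem3p6:
  fixes chi :: "(real ^ 'n) measure"
    and R :: "(real \<Rightarrow> real ^ 'n) measure"
    and \<pi> :: "((real ^ 'n) \<times> (real ^ 'n)) measure"
  assumes "prob_space chi" and "sets chi = sets borel"
    and "brownian_law chi R"
    and "prob_space \<pi>" and "sets \<pi> = sets borel"
    and "distr \<pi> borel fst = centred_gaussian (1 / 4)"
    and "distr \<pi> borel snd = centred_gaussian (1 / 4)"
  shows "(\<exists>!P. BS_solution R (\<lambda>t. centred_gaussian (1 / 4)) \<pi> P) \<longleftrightarrow>
         rel_entropy \<pi> (endpoint_law R) < \<infinity>"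
proof
  interpret brownian_motion chi R by unfold_locales fact
  have ends: "(\<lambda>\<omega>. (\<omega> 0, \<omega> 1)) \<in> borel_measurable P"
    if "sets P = sets R" for P :: "(real \<Rightarrow> real ^ 'n) measure"
    unfolding borel_prod[symmetric] using that sets_R
    by (intro measurable_Pair measurable_path_eval) auto
  {
    assume "\<exists>!P. BS_solution R (\<lambda>t. centred_gaussian (1 / 4)) \<pi> P"
    then obtain P where P: "path_law P" "endpoint_law P = \<pi>" "rel_entropy P R < \<infinity>"
      by (auto simp: BS_solution_def BS_admissible_def)
    then have "rel_entropy (endpoint_law P) (endpoint_law R) < \<infinity>"
      unfolding endpoint_law_def path_law_def
      by (intro finite_rel_entropy_distr ends) (auto simp: sets_R)
    then show "rel_entropy \<pi> (endpoint_law R) < \<infinity>" using P(2) by simp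
  }
  assume fin: "rel_entropy \<pi> (endpoint_law R) < \<infinity>"
  interpret E: prob_space "endpoint_law R"
    unfolding endpoint_law_def by (rule prob_space_distr[OF ends[OF refl]])
  have "sets \<pi> = sets (endpoint_law R)" using assms(5) by (simp add: endpoint_law_def)
  from E.finite_rel_entropyE[OF assms(4) this fin]
  obtain \<rho> where "prob_density_on (endpoint_law R) \<rho>" "\<pi> = density (endpoint_law R) \<rho>"
      "integrable (endpoint_law R) (\<lambda>z. \<rho> z * ln (\<rho> z))"
    by metis
  then interpret bridged_coupling chi R \<pi> \<rho>
    using assms by unfold_locales auto
  let ?\<gamma> = "centred_gaussian (1 / 4) :: (real ^ 'n) measure"
  \<comment> \<open>Each marginal constraint prescribes the probability of every preimage of a Borel
    set, at all times and for the endpoint pair. This encoding, justified by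
    \<open>distr_eq_iff_measure\<close>, brings the problem under
    \<open>unique_entropy_projection\<close>.\<close>
  define K where "K =
    (\<Union>t\<in>{0..1}. (\<lambda>A. ((\<lambda>\<omega>. \<omega> t) -` A \<inter> space R, measure ?\<gamma> A)) ` sets borel) \<union>
    (\<lambda>A. ((\<lambda>\<omega>. (\<omega> 0, \<omega> 1)) -` A \<inter> space R, measure \<pi> A)) ` sets borel"
  have K: "E \<in> events" if "(E, c) \<in> K" for E c
    using that ends[OF refl] by (auto simp: K_def intro!: measurable_sets[where A = borel])
  have adm: "BS_admissible (\<lambda>t. centred_gaussian (1 / 4)) \<pi> P \<longleftrightarrow>
      prob_space P \<and> sets P = events \<and> (\<forall>(E, c)\<in>K. measure P E = c)" for P
  proof (cases "prob_space P \<and> sets P = events")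
    case True
    then have P: "prob_space P" "sets P = events" and sp: "space P = space R"
      by (auto dest: sets_eq_imp_space_eq)
    have "marginal P t = ?\<gamma> \<longleftrightarrow>
        (\<forall>A\<in>sets borel. measure P ((\<lambda>\<omega>. \<omega> t) -` A \<inter> space R) = measure ?\<gamma> A)"
      if "t \<in> {0..1}" for t
      unfolding marginal_def sp[symmetric] using that P sets_R
      by (intro distr_eq_iff_measure prob_space_centred_gaussian measurable_path_eval)
         (auto simp: centred_gaussian_def)
    moreover have "endpoint_law P = \<pi> \<longleftrightarrow>
        (\<forall>A\<in>sets borel. measure P ((\<lambda>\<omega>. (\<omega> 0, \<omega> 1)) -` A \<inter> space R) = measure \<pi> A)"
      unfolding endpoint_law_def sp[symmetric] using P assms(4,5)
      by (intro distr_eq_iff_measure ends) auto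
    moreover have "(\<forall>(E, c)\<in>K. measure P E = c) \<longleftrightarrow>
        (\<forall>t\<in>{0..1}. \<forall>A\<in>sets borel. measure P ((\<lambda>\<omega>. \<omega> t) -` A \<inter> space R) = measure ?\<gamma> A) \<and>
        (\<forall>A\<in>sets borel. measure P ((\<lambda>\<omega>. (\<omega> 0, \<omega> 1)) -` A \<inter> space R) = measure \<pi> A)"
      by (simp add: K_def ball_Un)
    ultimately show ?thesis
      using P by (simp add: BS_admissible_def path_law_def sets_R)
  qed (auto simp: BS_admissible_def path_law_def sets_R)
  show "\<exists>!P. BS_solution R (\<lambda>t. centred_gaussian (1 / 4)) \<pi> P"
    unfolding BS_solution_def
    by (rule unique_entropy_projection[OF K adm bridged_law_admissible bridged_law_finite_entropy])
qed

end
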